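(* Let $m\in\mathbb N$, $c>0$ and $\theta>0$, with $m^3\theta$ sufficiently small. Suppose that a rank-$m$ orthogonal projection $P$ on $\ell^2(\mathbb Z^d)$ satisfies $$\max_{x,y\in\mathbb Z^d}|P(x,y)|\,e^{c|x-y|}\le\theta^{-1}.$$ Then $P=\sum_{i=1}^mP_i$, where the $P_i=|\psi_i\rangle\langle\psi_i|$ are mutually orthogonal rank-one projections, with normalized $\psi_i$, satisfying the following for each $i$: - $M(\psi_i)\ge|\ln\theta|^{-d-1}$; - for some $x_i\in\mathbb Z^d$ and all $y\in\mathbb Z^d$, $$|\psi_i(y)|\le\theta^{-2}e^{-c'|y-x_i|/m},$$ where $c'>0$ is a constant independent of $m$.
   Context: Distances on $\mathbb Z^d$ are $\ell^\infty$. $P(x,y)=\langle\delta_x,P\delta_y\rangle$. For $\psi\in\ell^2(\mathbb Z^d)$, $M(\psi)=\max_{x\in\mathbb Z^d}|\psi(x)|^2$. *)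

theory Defs
  imports "HOL-Analysis.Analysis"
begin

type_synonym 'd lat = "int ^ 'd"

definition linf_dist :: "'d::finite lat \<Rightarrow> 'd lat \<Rightarrow> real" where
  "linf_dist x y = Max (range (\<lambda>i. real_of_int \<bar>x $ i - y $ i\<bar>))"

definition in_l2 :: "('d::finite lat \<Rightarrow> complex) \<Rightarrow> bool" where
  "in_l2 \<psi> \<longleftrightarrow> (\<lambda>x. (cmod (\<psi> x))\<^sup>2) summable_on UNIV"

definition l2_inner :: "('d::finite lat \<Rightarrow> complex) \<Rightarrow> ('d lat \<Rightarrow> complex) \<Rightarrow> complex" where
  "l2_inner \<psi> \<phi> = infsum (\<lambda>x. cnj (\<psi> x) * \<phi> x) UNIV"

definition ker_apply :: "('d::finite lat \<Rightarrow> 'd lat \<Rightarrow> complex) \<Rightarrow> ('d lat \<Rightarrow> complex) \<Rightarrow> ('d lat \<Rightarrow> complex)" where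
  "ker_apply P \<psi> = (\<lambda>x. infsum (\<lambda>y. P x y * \<psi> y) UNIV)"

definition is_orth_proj :: "('d::finite lat \<Rightarrow> 'd lat \<Rightarrow> complex) \<Rightarrow> bool" where
  "is_orth_proj P \<longleftrightarrow>
     (\<forall>\<psi>. in_l2 \<psi> \<longrightarrow> (\<forall>x. (\<lambda>y. P x y * \<psi> y) summable_on UNIV) \<and> in_l2 (ker_apply P \<psi>)) \<and>
     (\<forall>\<psi>. in_l2 \<psi> \<longrightarrow> ker_apply P (ker_apply P \<psi>) = ker_apply P \<psi>) \<and>
     (\<forall>\<psi> \<phi>. in_l2 \<psi> \<longrightarrow> in_l2 \<phi> \<longrightarrow> l2_inner \<psi> (ker_apply P \<phi>) = l2_inner (ker_apply P \<psi>) \<phi>)"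

definition has_rank :: "('d::finite lat \<Rightarrow> 'd lat \<Rightarrow> complex) \<Rightarrow> nat \<Rightarrow> bool" where
  "has_rank P m \<longleftrightarrow> (\<exists>b :: nat \<Rightarrow> ('d lat \<Rightarrow> complex).
     (\<forall>c :: nat \<Rightarrow> complex. (\<lambda>x. \<Sum>i<m. c i * b i x) = (\<lambda>x. 0) \<longrightarrow> (\<forall>i<m. c i = 0)) \<and>
     {ker_apply P \<psi> | \<psi>. in_l2 \<psi>} = {(\<lambda>x. \<Sum>i<m. c i * b i x) | c. True})"

definition rank_orth_proj :: "nat \<Rightarrow> ('d::finite lat \<Rightarrow> 'd lat \<Rightarrow> complex) \<Rightarrow> bool" where
  "rank_orth_proj m P \<longleftrightarrow> is_orth_proj P \<and> has_rank P m"

text \<open>M(psi) = max_x |psi(x)|^2 (the maximum exists for l^2 functions; we use Sup).\<close>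
definition Mmax :: "('d::finite lat \<Rightarrow> complex) \<Rightarrow> real" where
  "Mmax \<psi> = (SUP x. (cmod (\<psi> x))\<^sup>2)"

end

theory Submission
  imports Defs "Jordan_Normal_Form.Spectral_Radius"
begin

text \<open>
  Write \<open>\<theta> = exp (- \<Lambda>)\<close>. The points where \<open>P x x\<close> exceeds \<open>exp (- 4 \<Lambda>)\<close> are covered by at most
  \<open>2 m\<close> balls of radius \<open>O(\<Lambda>)\<close>, since around each of them \<open>P\<close> has local trace at least \<open>1/2\<close>; away
  from these balls the range of \<open>P\<close> decays exponentially at a rate independent of \<open>m\<close>. Group the ball
  centers into clusters with mutual distance at least \<open>C \<Lambda>\<close>, of diameter \<open>O(m \<Lambda>)\<close>, and let \<open>f\<close> be the
  integer label of the cluster nearest to a point. If \<open>P f P \<psi> = \<mu> \<psi>\<close>, then \<open>(f - \<mu>) \<psi> = [f, P] \<psi>\<close>, where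
  the commutator is tiny; hence \<open>\<psi>\<close> decays exponentially away from the single cluster whose label is
  nearest to \<open>\<mu>\<close>. Because clusters have diameter \<open>O(m \<Lambda>)\<close>, this is decay at rate \<open>c'/m\<close> with prefactor
  a power of \<open>1/\<theta>\<close>.

  The modes of one cluster, \<open>r\<close> in number, live on \<open>O(r \<Lambda>\<^sup>d)\<close> points. Choosing greedily a point where the
  remaining kernel is largest on the diagonal gives at least \<open>r/2\<close> orthonormal vectors with
  \<open>M \<ge> const / \<Lambda>\<^sup>d\<close>. Replacing a good vector \<open>a\<close> and a remaining vector \<open>b\<close> by \<open>(a \<plusminus> \<alpha> b) / \<surd>2\<close> with a
  suitable phase \<open>\<alpha>\<close> makes both good at the cost of a factor 2.
\<close>

text \<open>Integer labels make the commutator argument independent of the spectrum of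
  \<open>P f P\<close>. Distinct labels differ by at least 1, so any \<open>\<mu>\<close> is at
  distance at least 1/2 from every label except a nearest one, and no gap between eigenvalues is
  required.

  The factor \<open>m\<close> is lost from the rate only at the very end. A mode decays at a rate
  comparable to \<open>c\<close> away from its whole cluster, but the theorem asks for one center.
  Replacing the cluster by a point costs a factor \<open>exp (O(m \<Lambda>))\<close>; since unit
  vectors are bounded by 1 pointwise, the bound may be raised to the power \<open>1/(15 m)\<close>,
  which turns this factor into a fixed power of \<open>1/\<theta>\<close>.

  The lower bound on \<open>M\<close> must not see \<open>m\<close>. To this end the number of
  centers of a cluster is bounded by the number of its own modes, so the average of the kernel
  diagonal near the cluster is of order \<open>\<Lambda>^(-d)\<close>. The remaining power of
  \<open>\<Lambda>\<close> in the theorem absorbs constants. The smallness of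
  \<open>m^3 \<theta>\<close> enters as \<open>m \<le> exp \<Lambda>\<close> together with
  \<open>\<Lambda>\<close> large.\<close>

type_synonym 'd wave = "'d lat \<Rightarrow> complex"

section \<open>Square-summable functions\<close>

lemma summable_cnj_mult:
  assumes "in_l2 \<psi>" "in_l2 \<phi>"
  shows "(\<lambda>x. cnj (\<psi> x) * \<phi> x) summable_on UNIV"
proof (rule abs_summable_summable, rule Infinite_Sum.abs_summable_on_comparison_test')
  show "(\<lambda>x. (cmod (\<psi> x))\<^sup>2 + (cmod (\<phi> x))\<^sup>2) summable_on UNIV"
    using assms unfolding in_l2_def by (rule summable_on_add)
  show "norm (cnj (\<psi> x) * \<phi> x) \<le> (cmod (\<psi> x))\<^sup>2 + (cmod (\<phi> x))\<^sup>2" for x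
  proof -
    have "2 * (cmod (\<psi> x) * cmod (\<phi> x)) \<le> (cmod (\<psi> x))\<^sup>2 + (cmod (\<phi> x))\<^sup>2"
      using sum_squares_bound[of "cmod (\<psi> x)" "cmod (\<phi> x)"] by simp
    moreover have "0 \<le> cmod (\<psi> x) * cmod (\<phi> x)" by simp
    ultimately show ?thesis unfolding norm_mult complex_mod_cnj by linarith
  qed
qed

lemma has_sum_l2_inner:
  assumes "in_l2 \<psi>" "in_l2 \<phi>"
  shows "((\<lambda>x. cnj (\<psi> x) * \<phi> x) has_sum l2_inner \<psi> \<phi>) UNIV"
  unfolding l2_inner_def using summable_cnj_mult[OF assms] by (rule has_sum_infsum)

lemma l2_inner_eqI:
  assumes "((\<lambda>x. cnj (\<psi> x) * \<phi> x) has_sum s) UNIV"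
  shows "l2_inner \<psi> \<phi> = s"
  unfolding l2_inner_def using assms by (rule infsumI)

lemma in_l2_dominated:
  assumes "in_l2 \<phi>" "\<And>x. cmod (\<psi> x) \<le> C * cmod (\<phi> x)"
  shows "in_l2 \<psi>"
  unfolding in_l2_def
proof (rule summable_on_comparison_test)
  show "(\<lambda>x. C\<^sup>2 * (cmod (\<phi> x))\<^sup>2) summable_on UNIV"
    using assms(1) unfolding in_l2_def by (rule summable_on_cmult_right)
  show "(cmod (\<psi> x))\<^sup>2 \<le> C\<^sup>2 * (cmod (\<phi> x))\<^sup>2" for x
    using power_mono[OF assms(2)[of x], of 2] by (simp add: power_mult_distrib)
qed auto

lemma in_l2_zero: "in_l2 (\<lambda>x. 0)"
  by (simp add: in_l2_def)

lemma in_l2_cmult: "in_l2 \<psi> \<Longrightarrow> in_l2 (\<lambda>x. a * \<psi> x)"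
  by (erule in_l2_dominated[where C = "cmod a"]) (simp add: norm_mult)

lemma in_l2_add:
  assumes "in_l2 \<psi>" "in_l2 \<phi>"
  shows "in_l2 (\<lambda>x. \<psi> x + \<phi> x)"
  unfolding in_l2_def
proof (rule summable_on_comparison_test)
  show "(\<lambda>x. 2 * ((cmod (\<psi> x))\<^sup>2 + (cmod (\<phi> x))\<^sup>2)) summable_on UNIV"
    using assms unfolding in_l2_def by (intro summable_on_cmult_right summable_on_add)
  show "(cmod (\<psi> x + \<phi> x))\<^sup>2 \<le> 2 * ((cmod (\<psi> x))\<^sup>2 + (cmod (\<phi> x))\<^sup>2)" for x
  proof -
    have "(cmod (\<psi> x + \<phi> x))\<^sup>2 \<le> (cmod (\<psi> x) + cmod (\<phi> x))\<^sup>2"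
      by (intro power_mono norm_triangle_ineq) auto
    also have "\<dots> \<le> 2 * ((cmod (\<psi> x))\<^sup>2 + (cmod (\<phi> x))\<^sup>2)"
      using sum_squares_bound[of "cmod (\<psi> x)" "cmod (\<phi> x)"] by (simp add: power2_sum)
    finally show ?thesis .
  qed
qed auto

lemma in_l2_diff:
  assumes "in_l2 \<psi>" "in_l2 \<phi>"
  shows "in_l2 (\<lambda>x. \<psi> x - \<phi> x)"
  using in_l2_add[OF assms(1) in_l2_cmult[OF assms(2), of "-1"]] by simp

lemma in_l2_sum:
  assumes "\<And>i. i \<in> I \<Longrightarrow> in_l2 (\<phi> i)"
  shows "in_l2 (\<lambda>x. \<Sum>i\<in>I. \<phi> i x)"
  using assms by (induction I rule: infinite_finite_induct) (auto intro: in_l2_zero in_l2_add)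

lemma in_l2_comb:
  assumes "\<And>i. i \<in> I \<Longrightarrow> in_l2 (\<phi> i)"
  shows "in_l2 (\<lambda>x. \<Sum>i\<in>I. a i * \<phi> i x)"
  by (intro in_l2_sum in_l2_cmult assms)

lemma l2_inner_add_right:
  assumes "in_l2 \<psi>" "in_l2 \<phi>" "in_l2 \<eta>"
  shows "l2_inner \<psi> (\<lambda>x. \<phi> x + \<eta> x) = l2_inner \<psi> \<phi> + l2_inner \<psi> \<eta>"
proof (rule l2_inner_eqI)
  show "((\<lambda>x. cnj (\<psi> x) * (\<phi> x + \<eta> x)) has_sum l2_inner \<psi> \<phi> + l2_inner \<psi> \<eta>) UNIV"
    using has_sum_add[OF has_sum_l2_inner[OF assms(1,2)] has_sum_l2_inner[OF assms(1,3)]]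
    by (simp add: distrib_left)
qed

lemma l2_inner_cmult_right:
  assumes "in_l2 \<psi>" "in_l2 \<phi>"
  shows "l2_inner \<psi> (\<lambda>x. a * \<phi> x) = a * l2_inner \<psi> \<phi>"
proof (rule l2_inner_eqI)
  show "((\<lambda>x. cnj (\<psi> x) * (a * \<phi> x)) has_sum a * l2_inner \<psi> \<phi>) UNIV"
    using has_sum_cmult_right[OF has_sum_l2_inner[OF assms], of a] by (simp add: mult_ac)
qed

lemma l2_inner_zero_right [simp]: "l2_inner \<psi> (\<lambda>x. 0) = 0"
  by (simp add: l2_inner_def)

lemma l2_inner_diff_right:
  assumes "in_l2 \<psi>" "in_l2 \<phi>" "in_l2 \<eta>"
  shows "l2_inner \<psi> (\<lambda>x. \<phi> x - \<eta> x) = l2_inner \<psi> \<phi> - l2_inner \<psi> \<eta>"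
  using l2_inner_add_right[OF assms(1,2) in_l2_cmult[OF assms(3), of "-1"]]
    l2_inner_cmult_right[OF assms(1,3), of "-1"] by simp

lemma l2_inner_comb_right:
  assumes "in_l2 \<psi>" "\<And>i. i \<in> I \<Longrightarrow> in_l2 (\<phi> i)"
  shows "l2_inner \<psi> (\<lambda>x. \<Sum>i\<in>I. a i * \<phi> i x) = (\<Sum>i\<in>I. a i * l2_inner \<psi> (\<phi> i))"
  using assms(2)
  by (induction I rule: infinite_finite_induct)
    (simp_all add: assms(1) l2_inner_add_right l2_inner_cmult_right in_l2_cmult in_l2_comb)

lemma l2_inner_cnj: "cnj (l2_inner \<psi> \<phi>) = l2_inner \<phi> \<psi>"
  unfolding l2_inner_def infsum_cnj[symmetric] by (simp add: mult.commute)

lemma l2_inner_cmult_left: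
  assumes "in_l2 \<psi>" "in_l2 \<phi>"
  shows "l2_inner (\<lambda>x. a * \<psi> x) \<phi> = cnj a * l2_inner \<psi> \<phi>"
  using l2_inner_cmult_right[OF assms(2,1), of a, THEN arg_cong, of cnj] by (simp add: l2_inner_cnj)

lemma l2_inner_add_left:
  assumes "in_l2 \<psi>" "in_l2 \<phi>" "in_l2 \<eta>"
  shows "l2_inner (\<lambda>x. \<phi> x + \<eta> x) \<psi> = l2_inner \<phi> \<psi> + l2_inner \<eta> \<psi>"
  using l2_inner_add_right[OF assms, THEN arg_cong, of cnj] by (simp add: l2_inner_cnj)

lemma l2_inner_diff_left:
  assumes "in_l2 \<psi>" "in_l2 \<phi>" "in_l2 \<eta>"
  shows "l2_inner (\<lambda>x. \<phi> x - \<eta> x) \<psi> = l2_inner \<phi> \<psi> - l2_inner \<eta> \<psi>"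
  using l2_inner_diff_right[OF assms, THEN arg_cong, of cnj] by (simp add: l2_inner_cnj)

lemma l2_inner_comb_left:
  assumes "in_l2 \<psi>" "\<And>i. i \<in> I \<Longrightarrow> in_l2 (\<phi> i)"
  shows "l2_inner (\<lambda>x. \<Sum>i\<in>I. a i * \<phi> i x) \<psi> = (\<Sum>i\<in>I. cnj (a i) * l2_inner (\<phi> i) \<psi>)"
proof -
  have "l2_inner (\<lambda>x. \<Sum>i\<in>I. a i * \<phi> i x) \<psi> = cnj (l2_inner \<psi> (\<lambda>x. \<Sum>i\<in>I. a i * \<phi> i x))"
    by (simp add: l2_inner_cnj)
  also have "\<dots> = (\<Sum>i\<in>I. cnj (a i) * cnj (l2_inner \<psi> (\<phi> i)))"
    by (simp add: l2_inner_comb_right assms)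
  finally show ?thesis by (simp add: l2_inner_cnj)
qed

lemma has_sum_norm_sq:
  assumes "in_l2 \<psi>"
  shows "((\<lambda>x. (cmod (\<psi> x))\<^sup>2) has_sum Re (l2_inner \<psi> \<psi>)) UNIV"
proof -
  have "((\<lambda>x. Re (cnj (\<psi> x) * \<psi> x)) has_sum Re (l2_inner \<psi> \<psi>)) UNIV"
    by (rule has_sum_Re[OF has_sum_l2_inner[OF assms assms]])
  moreover have "Re (cnj z * z) = (cmod z)\<^sup>2" for z
    by (metis Re_complex_of_real complex_norm_square mult.commute)
  ultimately show ?thesis by simp
qed

lemma l2_inner_self_eq:
  assumes "in_l2 \<psi>"
  shows "l2_inner \<psi> \<psi> = of_real (\<Sum>\<^sub>\<infinity>x. (cmod (\<psi> x))\<^sup>2)"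
proof -
  have "Im (l2_inner \<psi> \<psi>) = 0"
    using l2_inner_cnj[of \<psi> \<psi>] by (simp add: complex_eq_iff)
  then show ?thesis
    using infsumI[OF has_sum_norm_sq[OF assms]] by (simp add: complex_eq_iff)
qed

lemma l2_inner_self_nonneg: "in_l2 \<psi> \<Longrightarrow> 0 \<le> Re (l2_inner \<psi> \<psi>)"
  by (rule has_sum_nonneg[OF has_sum_norm_sq]) auto

lemma l2_inner_self_zero:
  assumes "in_l2 \<psi>" "l2_inner \<psi> \<psi> = 0"
  shows "\<psi> x = 0"
  using nonneg_has_sum_le_0D[of "\<lambda>x. (cmod (\<psi> x))\<^sup>2" UNIV "Re (l2_inner \<psi> \<psi>)" x]
    has_sum_norm_sq[OF assms(1)] assms(2) by auto

lemma sum_norm_sq_le: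
  assumes "in_l2 \<psi>" "finite F"
  shows "(\<Sum>x\<in>F. (cmod (\<psi> x))\<^sup>2) \<le> Re (l2_inner \<psi> \<psi>)"
  by (rule finite_sum_le_has_sum[OF has_sum_norm_sq[OF assms(1)]]) (use assms in auto)

lemma unit_le_one:
  assumes "in_l2 \<psi>" "l2_inner \<psi> \<psi> = 1"
  shows "cmod (\<psi> x) \<le> 1"
  using sum_norm_sq_le[OF assms(1), of "{x}"] assms(2) by (simp add: abs_square_le_1)

definition delta :: "'d::finite lat \<Rightarrow> 'd wave" where
  "delta y = (\<lambda>x. if x = y then 1 else 0)"

lemma in_l2_delta: "in_l2 (delta y)"
proof -
  have "(\<lambda>x. (cmod (delta y x))\<^sup>2) summable_on {y}" by simp
  then show ?thesis
    unfolding in_l2_def by (rule summable_on_cong_neutral[THEN iffD1, rotated -1]) (auto simp: delta_def)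
qed

lemma has_sum_delta: "((\<lambda>x. f x * delta y x) has_sum f y) UNIV"
  by (rule has_sum_finite_neutralI[of "{y}"]) (auto simp: delta_def)

lemma l2_inner_delta: "l2_inner \<psi> (delta y) = cnj (\<psi> y)"
  by (rule l2_inner_eqI) (rule has_sum_delta)

section \<open>Orthonormal families and their kernels\<close>

text \<open>Index sets are arbitrary finite sets, so that a basis can be split into blocks, changed
  block by block and reassembled without renumbering.\<close>

definition onf :: "nat set \<Rightarrow> (nat \<Rightarrow> 'd::finite wave) \<Rightarrow> bool" where
  "onf I \<psi> \<longleftrightarrow> finite I \<and> (\<forall>i\<in>I. in_l2 (\<psi> i)) \<and>
     (\<forall>i\<in>I. \<forall>j\<in>I. l2_inner (\<psi> i) (\<psi> j) = (if i = j then 1 else 0))"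

text \<open>For an orthonormal family this is the kernel of the orthogonal projection onto the span.
  Equality of kernels thus expresses equality of spans.\<close>

definition kern :: "nat set \<Rightarrow> (nat \<Rightarrow> 'd::finite wave) \<Rightarrow> 'd lat \<Rightarrow> 'd lat \<Rightarrow> complex" where
  "kern I \<psi> x y = (\<Sum>i\<in>I. \<psi> i x * cnj (\<psi> i y))"

definition in_ran :: "nat set \<Rightarrow> (nat \<Rightarrow> 'd::finite wave) \<Rightarrow> 'd wave \<Rightarrow> bool" where
  "in_ran I \<psi> \<phi> \<longleftrightarrow> in_l2 \<phi> \<and> (\<forall>x. \<phi> x = (\<Sum>i\<in>I. l2_inner (\<psi> i) \<phi> * \<psi> i x))"

lemma onfD:
  assumes "onf I \<psi>"
  shows "finite I" "i \<in> I \<Longrightarrow> in_l2 (\<psi> i)"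
    "i \<in> I \<Longrightarrow> l2_inner (\<psi> i) (\<psi> i) = 1"
    "i \<in> I \<Longrightarrow> j \<in> I \<Longrightarrow> i \<noteq> j \<Longrightarrow> l2_inner (\<psi> i) (\<psi> j) = 0"
  using assms by (auto simp: onf_def)

lemma onf_subset: "onf I \<psi> \<Longrightarrow> J \<subseteq> I \<Longrightarrow> onf J \<psi>"
  unfolding onf_def by (metis (no_types, lifting) finite_subset subset_iff)

lemma has_sum_sum:
  fixes f :: "'i \<Rightarrow> 'a \<Rightarrow> 'b :: topological_comm_monoid_add"
  assumes "\<And>i. i \<in> I \<Longrightarrow> (f i has_sum s i) A"
  shows "((\<lambda>x. \<Sum>i\<in>I. f i x) has_sum (\<Sum>i\<in>I. s i)) A"
  using assms by (induction I rule: infinite_finite_induct) (auto intro: has_sum_add)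

lemma has_sum_kern:
  assumes "finite I" "\<And>i. i \<in> I \<Longrightarrow> in_l2 (\<psi> i)" "in_l2 \<phi>"
  shows "((\<lambda>y. kern I \<psi> x y * \<phi> y) has_sum (\<Sum>i\<in>I. l2_inner (\<psi> i) \<phi> * \<psi> i x)) UNIV"
proof -
  have "((\<lambda>y. \<Sum>i\<in>I. \<psi> i x * (cnj (\<psi> i y) * \<phi> y)) has_sum (\<Sum>i\<in>I. \<psi> i x * l2_inner (\<psi> i) \<phi>)) UNIV"
    using assms by (intro has_sum_sum has_sum_cmult_right has_sum_l2_inner) auto
  then show ?thesis
    by (simp add: kern_def sum_distrib_left sum_distrib_right mult_ac)
qed

lemma in_ran_l2: "in_ran I \<psi> \<phi> \<Longrightarrow> in_l2 \<phi>"
  by (simp add: in_ran_def)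

lemma in_ran_kern:
  assumes "onf I \<psi>" "in_ran I \<psi> \<phi>"
  shows "((\<lambda>y. kern I \<psi> x y * \<phi> y) has_sum \<phi> x) UNIV"
  using has_sum_kern[of I \<psi> \<phi> x] assms by (auto simp: in_ran_def onf_def)

text \<open>An element of the span is fixed by the kernel, and the same kernel written in the other
  basis yields the other expansion.\<close>

lemma in_ran_cong:
  assumes "onf I \<psi>" "onf J \<psi>'" "kern I \<psi> = kern J \<psi>'" "in_ran I \<psi> \<phi>"
  shows "in_ran J \<psi>' \<phi>"
  unfolding in_ran_def
proof (intro conjI allI)
  show \<phi>: "in_l2 \<phi>" using assms(4) by (simp add: in_ran_def)
  show "\<phi> x = (\<Sum>i\<in>J. l2_inner (\<psi>' i) \<phi> * \<psi>' i x)" for x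
    using in_ran_kern[OF assms(1,4), of x] has_sum_kern[OF onfD(1,2)[OF assms(2)] \<phi>, where x = x]
    unfolding assms(3) by (rule has_sum_unique)
qed

lemma l2_inner_comb_member:
  assumes "onf I \<psi>" "j \<in> I"
  shows "l2_inner (\<psi> j) (\<lambda>x. \<Sum>i\<in>I. a i * \<psi> i x) = a j"
proof -
  note o = onfD[OF assms(1)]
  have "l2_inner (\<psi> j) (\<lambda>x. \<Sum>i\<in>I. a i * \<psi> i x) = (\<Sum>i\<in>I. a i * l2_inner (\<psi> j) (\<psi> i))"
    by (rule l2_inner_comb_right) (use o assms in auto)
  also have "\<dots> = (\<Sum>i\<in>I. if i = j then a i else 0)"
    using assms by (intro sum.cong) (auto simp: onf_def)
  finally show ?thesis using assms o(1) by simp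
qed

lemma in_ran_comb:
  assumes "onf I \<psi>"
  shows "in_ran I \<psi> (\<lambda>x. \<Sum>i\<in>I. a i * \<psi> i x)"
  unfolding in_ran_def using l2_inner_comb_member[OF assms, of _ a]
  by (auto intro!: in_l2_comb onfD(2)[OF assms] sum.cong)

lemma in_ran_member:
  assumes "onf I \<psi>" "i \<in> I"
  shows "in_ran I \<psi> (\<psi> i)"
proof -
  have "(\<Sum>k\<in>I. (if k = i then 1 else 0) * \<psi> k x) = \<psi> i x" for x
    using onfD(1)[OF assms(1)] assms(2) by (simp add: if_distrib if_distribR cong: if_cong)
  then show ?thesis
    using in_ran_comb[OF assms(1), of "\<lambda>k. if k = i then 1 else 0"] by simp
qed

lemma inner_in_ran_left:
  assumes "in_ran I \<psi> \<phi>" "onf I \<psi>" "in_l2 \<eta>"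
  shows "l2_inner \<phi> \<eta> = (\<Sum>i\<in>I. cnj (l2_inner (\<psi> i) \<phi>) * l2_inner (\<psi> i) \<eta>)"
proof -
  have "\<phi> = (\<lambda>x. \<Sum>i\<in>I. l2_inner (\<psi> i) \<phi> * \<psi> i x)"
    using assms(1) by (auto simp: in_ran_def)
  then have "l2_inner \<phi> \<eta> = l2_inner (\<lambda>x. \<Sum>i\<in>I. l2_inner (\<psi> i) \<phi> * \<psi> i x) \<eta>" by simp
  also have "\<dots> = (\<Sum>i\<in>I. cnj (l2_inner (\<psi> i) \<phi>) * l2_inner (\<psi> i) \<eta>)"
    by (rule l2_inner_comb_left) (use assms onfD in auto)
  finally show ?thesis .
qed

lemma in_ran_orthogonal:
  assumes "in_ran I \<psi> \<phi>" "onf I \<psi>" "in_l2 \<eta>" "\<And>i. i \<in> I \<Longrightarrow> l2_inner (\<psi> i) \<eta> = 0"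
  shows "l2_inner \<phi> \<eta> = 0"
  by (simp add: inner_in_ran_left[OF assms(1-3)] assms(4))

text \<open>Different blocks span orthogonal spaces, and equality of kernels keeps each new vector
  in the span of its old block. Summing the block kernels restores the full one.\<close>

lemma onf_glue:
  assumes "onf I \<psi>"
    and "\<And>n. n \<in> l ` I \<Longrightarrow> onf {i\<in>I. l i = n} (\<phi> n)"
    and "\<And>n. n \<in> l ` I \<Longrightarrow> kern {i\<in>I. l i = n} (\<phi> n) = kern {i\<in>I. l i = n} \<psi>"
  shows "onf I (\<lambda>i. \<phi> (l i) i)" "kern I (\<lambda>i. \<phi> (l i) i) = kern I \<psi>"
proof -
  have fin: "finite I" by (rule onfD[OF assms(1)])
  define B where "B n = {i\<in>I. l i = n}" for n
  have sub: "onf (B n) \<psi>" for n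
    by (rule onf_subset[OF assms(1)]) (auto simp: B_def)
  have on: "onf (B (l i)) (\<phi> (l i))" if "i \<in> I" for i
    using assms(2)[of "l i"] that by (auto simp: B_def)
  have ran: "in_ran (B (l i)) \<psi> (\<phi> (l i) i)" if "i \<in> I" for i
  proof (rule in_ran_cong[OF on[OF that] sub])
    show "kern (B (l i)) (\<phi> (l i)) = kern (B (l i)) \<psi>"
      using assms(3)[of "l i"] that by (auto simp: B_def)
    show "in_ran (B (l i)) (\<phi> (l i)) (\<phi> (l i) i)"
      by (rule in_ran_member[OF on[OF that]]) (use that in \<open>auto simp: B_def\<close>)
  qed
  have l2: "in_l2 (\<phi> (l i) i)" if "i \<in> I" for i
    using ran[OF that] by (simp add: in_ran_def)
  have "l2_inner (\<phi> (l i) i) (\<phi> (l j) j) = (if i = j then 1 else 0)" if "i \<in> I" "j \<in> I" for i j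
  proof (cases "l i = l j")
    case True
    then show ?thesis
      using on[OF that(1)] that by (simp add: onf_def B_def)
  next
    case False
    have "l2_inner (\<phi> (l i) i) (\<phi> (l j) j) = 0"
    proof (rule in_ran_orthogonal[OF ran[OF that(1)] sub l2[OF that(2)]])
      fix k assume k: "k \<in> B (l i)"
      have "l2_inner (\<phi> (l j) j) (\<psi> k) = 0"
      proof (rule in_ran_orthogonal[OF ran[OF that(2)] sub])
        show "in_l2 (\<psi> k)" using k onfD(2)[OF sub] by blast
        show "l2_inner (\<psi> q) (\<psi> k) = 0" if "q \<in> B (l j)" for q
          using False k that by (intro onfD(4)[OF assms(1)]) (auto simp: B_def)
      qed
      then show "l2_inner (\<psi> k) (\<phi> (l j) j) = 0"
        by (metis l2_inner_cnj complex_cnj_zero)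
    qed
    then show ?thesis using False by auto
  qed
  then show "onf I (\<lambda>i. \<phi> (l i) i)" using l2 fin by (simp add: onf_def)
  show "kern I (\<lambda>i. \<phi> (l i) i) = kern I \<psi>"
  proof (intro ext)
    fix x y
    have "kern I (\<lambda>i. \<phi> (l i) i) x y = (\<Sum>n\<in>l ` I. kern (B n) (\<lambda>i. \<phi> (l i) i) x y)"
      unfolding kern_def B_def by (rule sum.image_gen[OF fin])
    also have "\<dots> = (\<Sum>n\<in>l ` I. kern (B n) \<psi> x y)"
    proof (rule sum.cong[OF refl])
      fix n assume n: "n \<in> l ` I"
      have "kern (B n) (\<lambda>i. \<phi> (l i) i) x y = kern (B n) (\<phi> n) x y"
        unfolding kern_def B_def by (intro sum.cong) auto
      then show "kern (B n) (\<lambda>i. \<phi> (l i) i) x y = kern (B n) \<psi> x y"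
        using assms(3)[OF n] by (simp add: B_def)
    qed
    also have "\<dots> = kern I \<psi> x y"
      unfolding kern_def B_def by (rule sum.image_gen[OF fin, symmetric])
    finally show "kern I (\<lambda>i. \<phi> (l i) i) x y = kern I \<psi> x y" .
  qed
qed

lemma onf_replace:
  assumes "onf I \<psi>" "J \<subseteq> I" "onf J \<phi>" "kern J \<phi> = kern J \<psi>"
  shows "onf I (\<lambda>i. if i \<in> J then \<phi> i else \<psi> i)"
    "kern I (\<lambda>i. if i \<in> J then \<phi> i else \<psi> i) = kern I \<psi>"
proof -
  define l :: "nat \<Rightarrow> nat" where "l i = (if i \<in> J then 1 else 0)" for i
  have 1: "{i\<in>I. l i = 1} = J" and 0: "{i\<in>I. l i = 0} = I - J"
    using assms(2) by (auto simp: l_def)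
  define \<Phi> where "\<Phi> n = (if n = (1::nat) then \<phi> else \<psi>)" for n
  have a: "onf {i\<in>I. l i = n} (\<Phi> n)" "kern {i\<in>I. l i = n} (\<Phi> n) = kern {i\<in>I. l i = n} \<psi>"
    if "n \<in> l ` I" for n
  proof -
    have "n = 0 \<or> n = 1" using that by (auto simp: l_def split: if_splits)
    then show "onf {i\<in>I. l i = n} (\<Phi> n)" "kern {i\<in>I. l i = n} (\<Phi> n) = kern {i\<in>I. l i = n} \<psi>"
      using assms(3,4) onf_subset[OF assms(1), of "I - J"] 0 1 by (auto simp: \<Phi>_def)
  qed
  have "(\<lambda>i. \<Phi> (l i) i) = (\<lambda>i. if i \<in> J then \<phi> i else \<psi> i)"
    by (auto simp: \<Phi>_def l_def)
  then show "onf I (\<lambda>i. if i \<in> J then \<phi> i else \<psi> i)"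
    "kern I (\<lambda>i. if i \<in> J then \<phi> i else \<psi> i) = kern I \<psi>"
    using onf_glue[OF assms(1) a] by simp_all
qed

text \<open>The right side does not depend on the basis, so decay of the diagonal passes to every
  orthonormal basis of the span. This is how decay survives the later search for peaks.\<close>

lemma norm_sq_le_kern_diag:
  assumes "finite I" "i \<in> I"
  shows "(cmod (\<psi> i x))\<^sup>2 \<le> Re (kern I \<psi> x x)"
proof -
  have "Re (kern I \<psi> x x) = (\<Sum>i\<in>I. (cmod (\<psi> i x))\<^sup>2)"
    by (simp add: kern_def complex_mult_cnj cmod_power2)
  then show ?thesis
    using member_le_sum[OF assms(2), of "\<lambda>i. (cmod (\<psi> i x))\<^sup>2"] assms(1) by simp
qed

section \<open>Changing the orthonormal basis\<close>

text \<open>Householder reflection exchanging \<open>\<psi> i0\<close> with the phase-adjusted vector \<open>\<beta> u\<close>;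
  the phase makes the inner product of both real and nonpositive, so the reflection is never degenerate.\<close>
lemma onf_complete:
  assumes on: "onf I \<psi>" and i0: "i0 \<in> I" and u: "in_ran I \<psi> u" and uu: "l2_inner u u = 1"
  obtains \<psi>' \<beta> where "onf I \<psi>'" "kern I \<psi>' = kern I \<psi>" "cmod \<beta> = 1"
    "\<psi>' i0 = (\<lambda>x. \<beta> * u x)"
proof -
  note o = onfD[OF on]
  have u2: "in_l2 u" using u by (simp add: in_ran_def)
  define a where "a = l2_inner (\<psi> i0) u"
  define \<beta> where "\<beta> = (if a = 0 then 1 else - cnj a / of_real (cmod a))"
  have \<beta>1: "cmod \<beta> = 1" by (simp add: \<beta>_def norm_divide)
  have \<beta>c: "cnj \<beta> * \<beta> = 1"
    using complex_norm_square[of \<beta>] \<beta>1 by (simp add: mult.commute)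
  have \<beta>a: "\<beta> * a = - of_real (cmod a)"
    using complex_norm_square[of a]
    by (auto simp: \<beta>_def power2_eq_square divide_simps mult.commute)
  define w where "w x = \<beta> * u x - \<psi> i0 x" for x
  have bu2: "in_l2 (\<lambda>x. \<beta> * u x)" by (rule in_l2_cmult[OF u2])
  have w2: "in_l2 w" unfolding w_def by (rule in_l2_diff[OF bu2 o(2)[OF i0]])
  have pw: "l2_inner \<phi> w = \<beta> * l2_inner \<phi> u - l2_inner \<phi> (\<psi> i0)" if "in_l2 \<phi>" for \<phi>
    unfolding w_def using that
    by (simp add: l2_inner_diff_right bu2 o(2)[OF i0] l2_inner_cmult_right u2)
  \<comment> \<open>\<open>s\<close> is the squared norm of \<open>w\<close>, namely
    \<open>2 - 2 * Re (\<beta> * a)\<close> with \<open>\<beta> * a = - cmod a\<close>.\<close>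
  define s where "s = 2 + 2 * cmod a"
  have s0: "s > 0" by (simp add: s_def add_pos_nonneg)
  have i0w: "l2_inner (\<psi> i0) w = - of_real (s / 2)"
    by (simp add: pw o i0 a_def[symmetric] \<beta>a s_def field_simps)
  have uw: "l2_inner u w = \<beta> - cnj a"
    using l2_inner_cnj[of "\<psi> i0" u] by (simp add: pw u2 uu a_def)
  have ww: "l2_inner w w = of_real s"
  proof -
    have "l2_inner w \<phi> = cnj \<beta> * l2_inner u \<phi> - l2_inner (\<psi> i0) \<phi>" if "in_l2 \<phi>" for \<phi>
      unfolding w_def using that
      by (simp add: l2_inner_diff_left bu2 o(2)[OF i0] l2_inner_cmult_left u2)
    then have "l2_inner w w = cnj \<beta> * l2_inner u w - l2_inner (\<psi> i0) w" by (simp add: w2)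
    also have "\<dots> = 1 - cnj (\<beta> * a) + of_real (s / 2)"
      by (simp add: uw i0w right_diff_distrib \<beta>c)
    also have "\<dots> = of_real s" by (simp add: \<beta>a s_def field_simps)
    finally show ?thesis .
  qed
  define b where "b i = l2_inner (\<psi> i) w" for i
  define \<kappa> where "\<kappa> = (2 / s :: real)"
  define \<psi>' where "\<psi>' i x = \<psi> i x - (of_real \<kappa> * cnj (b i)) * w x" for i x
  have wi: "l2_inner w (\<psi> i) = cnj (b i)" for i
    by (simp add: b_def l2_inner_cnj)
  have l2': "in_l2 (\<psi>' i)" if "i \<in> I" for i
    unfolding \<psi>'_def by (intro in_l2_diff in_l2_cmult w2 o that)
  have ks: "of_real \<kappa> * of_real s = (2 :: complex)"
    using s0 unfolding of_real_mult[symmetric] by (simp add: \<kappa>_def)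
  have inn: "l2_inner (\<psi>' i) (\<psi>' j) = l2_inner (\<psi> i) (\<psi> j)" if "i \<in> I" "j \<in> I" for i j
  proof -
    have 1: "l2_inner (\<psi>' i) \<phi> = l2_inner (\<psi> i) \<phi> - of_real \<kappa> * b i * l2_inner w \<phi>" if "in_l2 \<phi>" for \<phi>
      unfolding \<psi>'_def[abs_def] using \<open>i \<in> I\<close> that
      by (simp add: l2_inner_diff_left o in_l2_cmult w2 l2_inner_cmult_left)
    have 2: "l2_inner \<phi> (\<psi>' j) = l2_inner \<phi> (\<psi> j) - of_real \<kappa> * cnj (b j) * l2_inner \<phi> w" if "in_l2 \<phi>" for \<phi>
      unfolding \<psi>'_def[abs_def] using \<open>j \<in> I\<close> that
      by (simp add: l2_inner_diff_right o in_l2_cmult w2 l2_inner_cmult_right)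
    have "l2_inner (\<psi>' i) (\<psi>' j) = l2_inner (\<psi> i) (\<psi> j) - of_real \<kappa> * cnj (b j) * b i
        - of_real \<kappa> * b i * (cnj (b j) - (of_real \<kappa> * of_real s) * cnj (b j))"
      using that by (simp add: 1 2 l2' o w2 wi ww b_def[symmetric] algebra_simps)
    then show ?thesis by (simp add: ks algebra_simps)
  qed
  have on': "onf I \<psi>'"
    using o(1) l2' inn on by (simp add: onf_def)
  \<comment> \<open>\<open>w\<close> lies in the span, so the reflection preserves the span, and
    with it the kernel.\<close>
  have wsum: "w x = (\<Sum>i\<in>I. b i * \<psi> i x)" for x
  proof -
    have "(\<Sum>i\<in>I. b i * \<psi> i x) = \<beta> * (\<Sum>i\<in>I. l2_inner (\<psi> i) u * \<psi> i x) - (\<Sum>i\<in>I. l2_inner (\<psi> i) (\<psi> i0) * \<psi> i x)"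
      unfolding sum_distrib_left sum_subtractf[symmetric]
      by (intro sum.cong) (simp_all add: b_def pw o algebra_simps)
    also have "\<dots> = \<beta> * u x - \<psi> i0 x"
      using u in_ran_member[OF on i0] by (simp add: in_ran_def)
    finally show ?thesis by (simp add: w_def)
  qed
  have bb: "(\<Sum>i\<in>I. cnj (b i) * b i) = of_real s"
  proof -
    have "l2_inner w w = l2_inner w (\<lambda>x. \<Sum>i\<in>I. b i * \<psi> i x)" using wsum by (metis ext)
    also have "\<dots> = (\<Sum>i\<in>I. b i * l2_inner w (\<psi> i))"
      by (rule l2_inner_comb_right[OF w2]) (rule o)
    finally show ?thesis by (simp add: ww wi mult.commute)
  qed
  have kern': "kern I \<psi>' = kern I \<psi>"
  proof (intro ext)
    fix x y
    have "kern I \<psi>' x y = (\<Sum>i\<in>I. \<psi> i x * cnj (\<psi> i y) - of_real \<kappa> * cnj (w y) * (b i * \<psi> i x)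
        - of_real \<kappa> * w x * (cnj (b i) * cnj (\<psi> i y))
        + of_real \<kappa> * of_real \<kappa> * w x * cnj (w y) * (cnj (b i) * b i))"
      unfolding kern_def \<psi>'_def by (intro sum.cong) (simp_all add: algebra_simps)
    also have "\<dots> = kern I \<psi> x y - of_real \<kappa> * cnj (w y) * w x - of_real \<kappa> * w x * cnj (w y)
        + of_real \<kappa> * w x * cnj (w y) * (of_real \<kappa> * of_real s)"
      unfolding sum.distrib sum_subtractf sum_distrib_left[symmetric] bb wsum[symmetric]
      by (simp add: kern_def wsum mult_ac)
    also have "\<dots> = kern I \<psi> x y" by (simp add: ks)
    finally show "kern I \<psi>' x y = kern I \<psi> x y" .
  qed
  have "\<psi>' i0 = (\<lambda>x. \<beta> * u x)"
  proof
    fix x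
    have "of_real \<kappa> * cnj (b i0) = - (of_real \<kappa> * of_real s / 2)"
      by (simp add: b_def i0w)
    then have "of_real \<kappa> * cnj (b i0) = -1" by (simp add: ks)
    then show "\<psi>' i0 x = \<beta> * u x" by (simp add: \<psi>'_def w_def)
  qed
  with on' kern' \<beta>1 show ?thesis by (rule that)
qed

text \<open>The phase puts \<open>\<alpha> * \<psi> b x\<close> at a right angle to
  \<open>\<psi> a x\<close> in the complex plane, so the sum and the difference both have modulus at
  least that of \<open>\<psi> a x\<close>. Normalization costs the factor 2.\<close>

lemma onf_rotate:
  assumes on: "onf I \<psi>" and ab: "a \<in> I" "b \<in> I" "a \<noteq> b"
  obtains \<psi>' where "onf I \<psi>'" "kern I \<psi>' = kern I \<psi>" "\<And>i. i \<noteq> a \<Longrightarrow> i \<noteq> b \<Longrightarrow> \<psi>' i = \<psi> i"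
    "2 * (cmod (\<psi>' a x))\<^sup>2 \<ge> (cmod (\<psi> a x))\<^sup>2" "2 * (cmod (\<psi>' b x))\<^sup>2 \<ge> (cmod (\<psi> a x))\<^sup>2"
proof -
  note o = onfD[OF on]
  define z where "z = \<psi> a x * cnj (\<psi> b x)"
  define \<alpha> where "\<alpha> = (if z = 0 then 1 else \<i> * z / of_real (cmod z))"
  have \<alpha>1: "cmod \<alpha> = 1" by (simp add: \<alpha>_def norm_divide norm_mult)
  have \<alpha>c: "\<alpha> * cnj \<alpha> = 1"
    using complex_norm_square[of \<alpha>] \<alpha>1 by simp
  have \<alpha>z: "Re (cnj \<alpha> * z) = 0"
    using complex_norm_square[of z] by (simp add: \<alpha>_def complex_eq_iff algebra_simps)
  define r :: complex where "r = of_real (1 / sqrt 2)"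
  have rr: "r * r = 1 / 2"
    unfolding r_def of_real_mult[symmetric] by (simp add: real_divide_square_eq)
  have cr: "cnj r = r" by (simp add: r_def)
  define A where "A y = r * (\<psi> a y + \<alpha> * \<psi> b y)" for y
  define B where "B y = r * (\<psi> a y - \<alpha> * \<psi> b y)" for y
  define \<psi>' where "\<psi>' = \<psi>(a := A, b := B)"
  have la: "in_l2 (\<psi> a)" "in_l2 (\<psi> b)" using o ab by auto
  have lAB: "in_l2 A" "in_l2 B"
    unfolding A_def B_def by (intro in_l2_cmult in_l2_add in_l2_diff la)+
  have AL: "l2_inner A \<phi> = r * (l2_inner (\<psi> a) \<phi> + cnj \<alpha> * l2_inner (\<psi> b) \<phi>)" if "in_l2 \<phi>" for \<phi>
    unfolding A_def[abs_def] using that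
    by (simp add: l2_inner_cmult_left l2_inner_add_left in_l2_add in_l2_cmult la cr)
  have BL: "l2_inner B \<phi> = r * (l2_inner (\<psi> a) \<phi> - cnj \<alpha> * l2_inner (\<psi> b) \<phi>)" if "in_l2 \<phi>" for \<phi>
    unfolding B_def[abs_def] using that
    by (simp add: l2_inner_cmult_left l2_inner_diff_left in_l2_diff in_l2_cmult la cr)
  have AR: "l2_inner \<phi> A = r * (l2_inner \<phi> (\<psi> a) + \<alpha> * l2_inner \<phi> (\<psi> b))" if "in_l2 \<phi>" for \<phi>
    unfolding A_def[abs_def] using that
    by (simp add: l2_inner_cmult_right l2_inner_add_right in_l2_add in_l2_cmult la)
  have BR: "l2_inner \<phi> B = r * (l2_inner \<phi> (\<psi> a) - \<alpha> * l2_inner \<phi> (\<psi> b))" if "in_l2 \<phi>" for \<phi>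
    unfolding B_def[abs_def] using that
    by (simp add: l2_inner_cmult_right l2_inner_diff_right in_l2_diff in_l2_cmult la)
  have self: "l2_inner (\<psi> a) (\<psi> a) = 1" "l2_inner (\<psi> b) (\<psi> b) = 1"
    "l2_inner (\<psi> a) (\<psi> b) = 0" "l2_inner (\<psi> b) (\<psi> a) = 0" using o ab by auto
  have "r * (r + \<alpha> * (r * cnj \<alpha>)) = (r * r) * (1 + \<alpha> * cnj \<alpha>)" by (simp add: algebra_simps)
  then have one: "r * (r + \<alpha> * (r * cnj \<alpha>)) = 1" by (simp add: rr \<alpha>c)
  have AA: "l2_inner A A = 1" and BB: "l2_inner B B = 1"
    and AB: "l2_inner A B = 0" and BA: "l2_inner B A = 0"
    by (simp_all add: AL BL lAB AR BR la self one \<alpha>c)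
  have off: "l2_inner A (\<psi> i) = 0" "l2_inner B (\<psi> i) = 0" "l2_inner (\<psi> i) A = 0" "l2_inner (\<psi> i) B = 0"
    if "i \<in> I" "i \<noteq> a" "i \<noteq> b" for i
    using that o ab by (simp_all add: AL BL AR BR)
  have "onf I \<psi>'"
    unfolding onf_def \<psi>'_def using o ab lAB AA BB AB BA off by auto
  moreover have "kern I \<psi>' = kern I \<psi>"
  proof (intro ext)
    fix y y'
    have split: "kern I f y y' = f a y * cnj (f a y') + (f b y * cnj (f b y') + kern (I - {a} - {b}) f y y')"
      for f :: "nat \<Rightarrow> 'a wave"
      unfolding kern_def using o(1) ab
      by (simp add: sum.remove[of I a] sum.remove[of "I - {a}" b])
    have "A y * cnj (A y') + B y * cnj (B y') = (r * r) * (2 * (\<psi> a y * cnj (\<psi> a y'))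
        + 2 * (\<alpha> * cnj \<alpha>) * (\<psi> b y * cnj (\<psi> b y')))"
      by (simp add: A_def B_def cr algebra_simps)
    also have "\<dots> = \<psi> a y * cnj (\<psi> a y') + \<psi> b y * cnj (\<psi> b y')"
      by (simp add: rr \<alpha>c)
    finally have "A y * cnj (A y') + B y * cnj (B y') = \<psi> a y * cnj (\<psi> a y') + \<psi> b y * cnj (\<psi> b y')" .
    moreover have "kern (I - {a} - {b}) \<psi>' y y' = kern (I - {a} - {b}) \<psi> y y'"
      unfolding kern_def \<psi>'_def by (intro sum.cong) auto
    ultimately show "kern I \<psi>' y y' = kern I \<psi> y y'"
      using ab by (simp add: split[of \<psi>'] split[of \<psi>]) (simp add: \<psi>'_def)
  qed
  moreover have "2 * (cmod (\<psi>' a x))\<^sup>2 \<ge> (cmod (\<psi> a x))\<^sup>2" "2 * (cmod (\<psi>' b x))\<^sup>2 \<ge> (cmod (\<psi> a x))\<^sup>2"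
  proof -
    have r2: "(cmod r)\<^sup>2 = 1 / 2" by (simp add: r_def norm_divide power_divide)
    have "Re (\<psi> a x * cnj (\<alpha> * \<psi> b x)) = 0" using \<alpha>z by (simp add: z_def mult_ac)
    then have "(cmod (\<psi> a x + \<alpha> * \<psi> b x))\<^sup>2 = (cmod (\<psi> a x))\<^sup>2 + (cmod (\<alpha> * \<psi> b x))\<^sup>2"
      "(cmod (\<psi> a x - \<alpha> * \<psi> b x))\<^sup>2 = (cmod (\<psi> a x))\<^sup>2 + (cmod (\<alpha> * \<psi> b x))\<^sup>2"
      unfolding cmod_power2 by (simp_all add: power2_eq_square algebra_simps)
    then show "2 * (cmod (\<psi>' a x))\<^sup>2 \<ge> (cmod (\<psi> a x))\<^sup>2" "2 * (cmod (\<psi>' b x))\<^sup>2 \<ge> (cmod (\<psi> a x))\<^sup>2"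
      using ab by (simp_all add: \<psi>'_def A_def B_def norm_mult power_mult_distrib r2)
  qed
  ultimately show ?thesis
    by (intro that[of \<psi>']) (auto simp: \<psi>'_def)
qed

section \<open>Orthonormal bases of vectors with large peaks\<close>

definition peak :: "real \<Rightarrow> 'd::finite wave \<Rightarrow> bool" where
  "peak g \<psi> \<longleftrightarrow> (\<exists>x. g \<le> (cmod (\<psi> x))\<^sup>2)"

lemma kern_diag: "Re (kern I \<psi> x x) = (\<Sum>i\<in>I. (cmod (\<psi> i x))\<^sup>2)"
  by (simp add: kern_def complex_mult_cnj cmod_power2)

lemma kern_diag_of_real: "kern I \<psi> x x = of_real (Re (kern I \<psi> x x))"
  by (simp add: kern_def complex_mult_cnj)

lemma sum_kern_diag_le:
  assumes "onf I \<psi>" "finite T"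
  shows "(\<Sum>x\<in>T. Re (kern I \<psi> x x)) \<le> card I"
proof -
  have "(\<Sum>x\<in>T. Re (kern I \<psi> x x)) = (\<Sum>i\<in>I. \<Sum>x\<in>T. (cmod (\<psi> i x))\<^sup>2)"
    unfolding kern_diag by (rule sum.swap)
  also have "\<dots> \<le> (\<Sum>i\<in>I. 1)"
    using sum_norm_sq_le[OF _ assms(2)] onfD[OF assms(1)] by (intro sum_mono) fastforce
  finally show ?thesis by simp
qed

lemma in_ran_column:
  assumes "onf I \<psi>"
  shows "in_ran I \<psi> (\<lambda>y. a * kern I \<psi> y x)"
proof -
  have "(\<lambda>y. a * kern I \<psi> y x) = (\<lambda>y. \<Sum>i\<in>I. (a * cnj (\<psi> i x)) * \<psi> i y)"
    by (simp add: kern_def sum_distrib_left mult_ac)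
  then show ?thesis using in_ran_comb[OF assms] by simp
qed

lemma l2_inner_column:
  assumes "onf I \<psi>"
  shows "l2_inner (\<lambda>y. kern I \<psi> y x) (\<lambda>y. kern I \<psi> y x) = kern I \<psi> x x"
proof -
  have r: "in_ran I \<psi> (\<lambda>y. kern I \<psi> y x)" using in_ran_column[OF assms, of 1 x] by simp
  have "((\<lambda>y. kern I \<psi> x y * kern I \<psi> y x) has_sum kern I \<psi> x x) UNIV"
    by (rule in_ran_kern[OF assms r])
  moreover have "cnj (kern I \<psi> y x) = kern I \<psi> x y" for y
    by (simp add: kern_def mult.commute)
  ultimately show ?thesis by (intro l2_inner_eqI) simp
qed

text \<open>The normalized column of the kernel at \<open>x\<close> attains the whole diagonal: its
  squared modulus at \<open>x\<close> is \<open>kern I \<psi> x x\<close>. Being a unit vector, it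
  removes at most 1 from the trace over \<open>T\<close>. The \<open>- 1\<close> reflects that the
  trace has to reach \<open>g * card T\<close> before each pick, not after the last one.\<close>

lemma onf_greedy:
  fixes g :: real
  assumes "onf I \<psi>" "finite T" "T \<noteq> {}" "h \<le> card I" "g > 0"
    "g * card T + real h - 1 \<le> (\<Sum>x\<in>T. Re (kern I \<psi> x x))"
  shows "\<exists>\<psi>' A. onf I \<psi>' \<and> kern I \<psi>' = kern I \<psi> \<and> A \<subseteq> I \<and> card A = h \<and> (\<forall>i\<in>A. peak g (\<psi>' i))"
  using assms
proof (induction h arbitrary: I \<psi>)
  case 0
  show ?case by (rule exI[of _ \<psi>], rule exI[of _ "{}"]) (use 0 in auto)
next
  case (Suc h)
  note on = Suc.prems(1) and fT = Suc.prems(2) and g = Suc.prems(5)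
  \<comment> \<open>The trace over \<open>T\<close> is still at least \<open>g * card T\<close>, so
    the mean of the diagonal is at least \<open>g\<close>.\<close>
  have "\<exists>x\<in>T. g \<le> Re (kern I \<psi> x x)"
  proof (rule ccontr)
    assume "\<not> ?thesis"
    then have "(\<Sum>x\<in>T. Re (kern I \<psi> x x)) < (\<Sum>x\<in>T. g)"
      using Suc.prems(3) fT by (intro sum_strict_mono) (auto simp: not_le)
    then show False using Suc.prems(6) by (simp add: mult.commute)
  qed
  then obtain x where gx: "g \<le> Re (kern I \<psi> x x)" by blast
  define p where "p = Re (kern I \<psi> x x)"
  define q :: complex where "q = of_real (1 / sqrt p)"
  have p: "p > 0" "g \<le> p" and kx: "kern I \<psi> x x = of_real p"
    using gx g kern_diag_of_real[of I \<psi> x] by (auto simp: p_def)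
  define u where "u y = q * kern I \<psi> y x" for y
  have ur: "in_ran I \<psi> u" unfolding u_def by (rule in_ran_column[OF on])
  have col: "in_l2 (\<lambda>y. kern I \<psi> y x)"
    using in_ran_l2[OF in_ran_column[OF on, of 1 x]] by simp
  have "l2_inner u u = cnj q * (q * of_real p)"
    unfolding u_def by (simp add: l2_inner_cmult_left l2_inner_cmult_right in_l2_cmult col l2_inner_column[OF on] kx)
  also have "\<dots> = 1"
    using p by (simp add: q_def of_real_mult[symmetric] real_divide_square_eq del: of_real_mult)
  finally have uu: "l2_inner u u = 1" .
  have ux: "(cmod (u x))\<^sup>2 = p"
    using p by (simp add: u_def kx q_def norm_mult norm_divide power_mult_distrib power_divide power2_eq_square)
  obtain i0 where i0: "i0 \<in> I" using Suc.prems(4) by (cases "I = {}") auto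
  obtain \<psi>1 \<beta> where \<psi>1: "onf I \<psi>1" "kern I \<psi>1 = kern I \<psi>" "cmod \<beta> = 1" "\<psi>1 i0 = (\<lambda>x. \<beta> * u x)"
    using onf_complete[OF on i0 ur uu] .
  define J where "J = I - {i0}"
  have fI: "finite I" by (rule onfD[OF on])
  have J: "onf J \<psi>1" by (rule onf_subset[OF \<psi>1(1)]) (auto simp: J_def)
  have "(\<Sum>x\<in>T. Re (kern I \<psi> x x)) = (\<Sum>x\<in>T. (cmod (\<psi>1 i0 x))\<^sup>2) + (\<Sum>x\<in>T. Re (kern J \<psi>1 x x))"
    unfolding \<psi>1(2)[symmetric] J_def sum.distrib[symmetric] kern_diag
    using fI i0 by (simp add: sum.remove)
  moreover have "(\<Sum>x\<in>T. (cmod (\<psi>1 i0 x))\<^sup>2) \<le> 1"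
    using sum_norm_sq_le[OF onfD(2)[OF \<psi>1(1) i0] fT] onfD(3)[OF \<psi>1(1) i0] by simp
  ultimately have "g * card T + real h - 1 \<le> (\<Sum>x\<in>T. Re (kern J \<psi>1 x x))"
    using Suc.prems(6) by simp
  moreover have "h \<le> card J" using Suc.prems(4) i0 fI by (simp add: J_def)
  ultimately obtain \<psi>2 A where 2: "onf J \<psi>2" "kern J \<psi>2 = kern J \<psi>1" "A \<subseteq> J" "card A = h"
    "\<forall>i\<in>A. peak g (\<psi>2 i)"
    using Suc.IH[OF J fT Suc.prems(3) _ g] by blast
  define \<psi>3 where "\<psi>3 i = (if i \<in> J then \<psi>2 i else \<psi>1 i)" for i
  have 3: "onf I \<psi>3" "kern I \<psi>3 = kern I \<psi>1"
    using onf_replace[OF \<psi>1(1) _ 2(1,2)] unfolding \<psi>3_def by (auto simp: J_def)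
  have "peak g (\<psi>1 i0)"
    unfolding peak_def by (rule exI[of _ x]) (use p ux in \<open>simp add: \<psi>1 norm_mult\<close>)
  then have pk: "\<forall>i\<in>insert i0 A. peak g (\<psi>3 i)"
    using 2(3,5) by (auto simp: \<psi>3_def J_def)
  have "i0 \<notin> A" "finite A" using 2(3) fI by (auto simp: J_def intro: finite_subset)
  then have "card (insert i0 A) = Suc h" "insert i0 A \<subseteq> I"
    using 2(3,4) i0 by (auto simp: J_def)
  with 3 pk show ?case unfolding \<psi>1(2) by blast
qed

lemma onf_pairing:
  assumes "finite B" "onf (A \<union> B) \<psi>" "A \<inter> B = {}" "card B \<le> card A" "\<forall>i\<in>A. peak g (\<psi> i)" "g \<ge> 0"
  shows "\<exists>\<psi>'. onf (A \<union> B) \<psi>' \<and> kern (A \<union> B) \<psi>' = kern (A \<union> B) \<psi> \<and> (\<forall>i\<in>A \<union> B. peak (g / 2) (\<psi>' i))"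
  using assms
proof (induction B arbitrary: A \<psi> rule: finite_induct)
  case empty
  have "peak (g / 2) (\<psi> i)" if i: "i \<in> A" for i
  proof -
    obtain x where "g \<le> (cmod (\<psi> i x))\<^sup>2" using empty.prems(4) i unfolding peak_def by blast
    then show ?thesis unfolding peak_def using empty.prems(5) by (intro exI[of _ x]) simp
  qed
  then show ?case using empty by auto
next
  case (insert b B)
  define I where "I = A \<union> insert b B"
  have on: "onf I \<psi>" using insert.prems(1) by (simp add: I_def)
  have fin: "finite A" using onfD(1)[OF on] by (simp add: I_def)
  have "card A > 0" using insert.prems(3) insert.hyps by simp
  then obtain a where a: "a \<in> A" by (metis card_gt_0_iff ex_in_conv)
  have ab: "a \<in> I" "b \<in> I" "a \<noteq> b" using a insert.prems(2) by (auto simp: I_def)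
  obtain x where x: "g \<le> (cmod (\<psi> a x))\<^sup>2" using insert.prems(4) a by (auto simp: peak_def)
  obtain \<psi>1 where 1: "onf I \<psi>1" "kern I \<psi>1 = kern I \<psi>" "\<And>i. i \<noteq> a \<Longrightarrow> i \<noteq> b \<Longrightarrow> \<psi>1 i = \<psi> i"
    "2 * (cmod (\<psi>1 a x))\<^sup>2 \<ge> (cmod (\<psi> a x))\<^sup>2" "2 * (cmod (\<psi>1 b x))\<^sup>2 \<ge> (cmod (\<psi> a x))\<^sup>2"
    using onf_rotate[OF on ab, of x] by metis
  define J where "J = (A - {a}) \<union> B"
  have J: "onf J \<psi>1" "J \<subseteq> I" "I = insert a (insert b J)"
    using a by (auto simp: J_def I_def intro: onf_subset[OF 1(1)])
  have pk1: "peak (g / 2) (\<psi>1 a)" "peak (g / 2) (\<psi>1 b)"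
    unfolding peak_def using x 1(4,5) by (auto intro!: exI[of _ x])
  have nb: "b \<notin> J" "a \<notin> J" using insert.hyps insert.prems(2) a by (auto simp: J_def)
  have "\<exists>\<psi>'. onf ((A - {a}) \<union> B) \<psi>' \<and> kern ((A - {a}) \<union> B) \<psi>' = kern ((A - {a}) \<union> B) \<psi>1 \<and>
      (\<forall>i\<in>(A - {a}) \<union> B. peak (g / 2) (\<psi>' i))"
  proof (rule insert.IH)
    show "onf ((A - {a}) \<union> B) \<psi>1" using J(1) by (simp add: J_def)
    show "(A - {a}) \<inter> B = {}" using insert.prems(2) by auto
    show "card B \<le> card (A - {a})" using insert.prems(3) insert.hyps a fin by simp
    show "\<forall>i\<in>A - {a}. peak g (\<psi>1 i)"
      using insert.prems(2,4) 1(3) by (metis Diff_iff Int_iff empty_iff insertI1)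
  qed (rule insert.prems)
  then obtain \<psi>2 where 2: "onf J \<psi>2" "kern J \<psi>2 = kern J \<psi>1" "\<forall>i\<in>J. peak (g / 2) (\<psi>2 i)"
    unfolding J_def by blast
  define \<psi>3 where "\<psi>3 i = (if i \<in> J then \<psi>2 i else \<psi>1 i)" for i
  have 3: "onf I \<psi>3" "kern I \<psi>3 = kern I \<psi>1"
    using onf_replace[OF 1(1) J(2) 2(1,2)] unfolding \<psi>3_def by auto
  have "\<forall>i\<in>I. peak (g / 2) (\<psi>3 i)"
    using J(3) 2(3) pk1 nb by (auto simp: \<psi>3_def)
  with 3 show ?case unfolding 1(2) unfolding I_def by blast
qed

lemma onf_all_peaks:
  fixes g :: real
  assumes "onf I \<psi>" "finite T" "T \<noteq> {}" "g > 0"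
    "g * card T + card I / 2 \<le> (\<Sum>x\<in>T. Re (kern I \<psi> x x))"
  shows "\<exists>\<psi>'. onf I \<psi>' \<and> kern I \<psi>' = kern I \<psi> \<and> (\<forall>i\<in>I. peak (g / 2) (\<psi>' i))"
proof -
  \<comment> \<open>Rounding up leaves no more vectors to repair than there are peaked ones; the
    \<open>- 1\<close> in the greedy hypothesis pays for it.\<close>
  define h where "h = (card I + 1) div 2"
  have h: "h \<le> card I" "card I - h \<le> h" "real h - 1 \<le> card I / 2"
    by (auto simp: h_def)
  obtain \<psi>1 A where 1: "onf I \<psi>1" "kern I \<psi>1 = kern I \<psi>" "A \<subseteq> I" "card A = h" "\<forall>i\<in>A. peak g (\<psi>1 i)"
    using onf_greedy[OF assms(1-3) h(1) assms(4)] assms(5) h(3) by fastforce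
  have fin: "finite I" by (rule onfD[OF assms(1)])
  have "A \<union> (I - A) = I" using 1(3) by auto
  moreover have "card (I - A) \<le> card A"
    using 1(3,4) h fin by (simp add: card_Diff_subset finite_subset)
  ultimately show ?thesis
    using onf_pairing[of "I - A" A \<psi>1 g] 1 fin assms(4) by (auto simp: 1(2))
qed

section \<open>Orthonormal bases of ranges and diagonalization\<close>

lemma complex_eigenvector_exists:
  fixes a :: "nat \<Rightarrow> nat \<Rightarrow> complex"
  assumes "n > 0"
  obtains v k j where "j < n" "v j \<noteq> 0" "\<And>i. i < n \<Longrightarrow> (\<Sum>j<n. a i j * v j) = k * v i"
proof -
  define A where "A = mat n n (\<lambda>(i, j). a i j)"
  have A: "A \<in> carrier_mat n n" by (simp add: A_def)
  obtain k w where w: "eigenvector A w k"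
    using spectrum_non_empty[OF A assms] by (auto simp: spectrum_def eigenvalue_def)
  then have wn: "dim_vec w = n" "w \<noteq> 0\<^sub>v n" "A *\<^sub>v w = k \<cdot>\<^sub>v w"
    using A by (auto simp: eigenvector_def)
  obtain j where j: "j < n" "vec_index w j \<noteq> 0"
    using wn by (metis eq_vecI index_zero_vec)
  have "(\<Sum>j<n. a i j * vec_index w j) = k * vec_index w i" if i: "i < n" for i
  proof -
    have "vec_index (A *\<^sub>v w) i = (\<Sum>j<n. a i j * vec_index w j)"
      using i wn(1) A by (auto simp: A_def scalar_prod_def atLeast0LessThan intro!: sum.cong)
    then show ?thesis using i wn(1) by (simp add: wn(3))
  qed
  with j show ?thesis by (rule that)
qed

lemma l2_normalize:
  assumes "in_l2 \<phi>" "\<phi> \<noteq> (\<lambda>x. 0)"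
  obtains q where "q \<noteq> 0" "l2_inner (\<lambda>x. q * \<phi> x) (\<lambda>x. q * \<phi> x) = 1"
proof -
  define t where "t = Re (l2_inner \<phi> \<phi>)"
  have t: "l2_inner \<phi> \<phi> = of_real t"
    unfolding t_def using l2_inner_self_eq[OF assms(1)] by simp
  have "t \<noteq> 0"
    using l2_inner_self_zero[OF assms(1)] assms(2) t by auto
  then have t0: "t > 0" using l2_inner_self_nonneg[OF assms(1)] by (simp add: t_def)
  define q :: complex where "q = of_real (1 / sqrt t)"
  have "l2_inner (\<lambda>x. q * \<phi> x) (\<lambda>x. q * \<phi> x) = cnj q * (q * of_real t)"
    by (simp add: l2_inner_cmult_left l2_inner_cmult_right in_l2_cmult assms(1) t)
  also have "\<dots> = 1"
    using t0 by (simp add: q_def of_real_mult[symmetric] real_divide_square_eq del: of_real_mult)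
  finally show ?thesis using t0 by (intro that[of q]) (auto simp: q_def)
qed

lemma l2_inner_mult_real:
  "l2_inner (\<lambda>x. of_real (f x) * \<phi> x) \<psi> = l2_inner \<phi> (\<lambda>x. of_real (f x) * \<psi> x)"
  by (simp add: l2_inner_def mult_ac)

lemma in_l2_mult_bounded:
  assumes "in_l2 \<phi>" "\<And>x. \<bar>f x\<bar> \<le> C"
  shows "in_l2 (\<lambda>x. of_real (f x) * \<phi> x)"
  by (rule in_l2_dominated[OF assms(1), of _ C]) (simp add: norm_mult assms(2) mult_right_mono)

text \<open>One eigenvector of the compression of \<open>f\<close> to the span becomes the last
  basis vector. Since \<open>f\<close> is real, the compression is symmetric and leaves the
  orthogonal complement of the eigenvector invariant, where the induction continues.\<close>

lemma onf_diagonalize: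
  fixes f :: "'d::finite lat \<Rightarrow> real"
  assumes "onf {..<n} \<psi>" "\<And>x. \<bar>f x\<bar> \<le> C"
  shows "\<exists>\<psi>'. onf {..<n} \<psi>' \<and> kern {..<n} \<psi>' = kern {..<n} \<psi> \<and>
    (\<forall>i<n. \<forall>j<n. i \<noteq> j \<longrightarrow> l2_inner (\<psi>' i) (\<lambda>x. of_real (f x) * \<psi>' j x) = 0)"
  using assms(1)
proof (induction n arbitrary: \<psi>)
  case 0
  then show ?case by blast
next
  case (Suc n)
  define I where "I = {..<Suc n}"
  have on: "onf I \<psi>" using Suc.prems by (simp add: I_def)
  note o = onfD[OF on]
  define F where "F \<phi> x = of_real (f x) * \<phi> x" for \<phi> :: "'d wave" and x
  have F2: "in_l2 (F \<phi>)" if "in_l2 \<phi>" for \<phi>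
    unfolding F_def by (rule in_l2_mult_bounded[OF that assms(2)])
  have Fs: "l2_inner (F \<phi>) \<eta> = l2_inner \<phi> (F \<eta>)" for \<phi> \<eta>
    unfolding F_def by (rule l2_inner_mult_real)
  obtain v k j where v: "j < Suc n" "v j \<noteq> 0"
    "\<And>i. i < Suc n \<Longrightarrow> (\<Sum>j<Suc n. l2_inner (\<psi> i) (F (\<psi> j)) * v j) = k * v i"
    by (rule complex_eigenvector_exists[of "Suc n" "\<lambda>i j. l2_inner (\<psi> i) (F (\<psi> j))"]) auto
  define u0 where "u0 x = (\<Sum>i\<in>I. v i * \<psi> i x)" for x
  have u0i: "l2_inner (\<psi> i) u0 = v i" if "i \<in> I" for i
    unfolding u0_def by (rule l2_inner_comb_member[OF on that])
  have u02: "in_l2 u0" unfolding u0_def by (rule in_l2_comb) (rule o)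
  have "u0 \<noteq> (\<lambda>x. 0)"
    using u0i[of j] v(1,2) by (auto simp: I_def)
  then obtain q where q: "q \<noteq> 0" "l2_inner (\<lambda>x. q * u0 x) (\<lambda>x. q * u0 x) = 1"
    using l2_normalize[OF u02] by blast
  define u where "u x = q * u0 x" for x
  have u2: "in_l2 u" unfolding u_def by (rule in_l2_cmult[OF u02])
  have "u = (\<lambda>x. \<Sum>i\<in>I. (q * v i) * \<psi> i x)"
    by (intro ext) (simp add: u_def u0_def sum_distrib_left mult_ac)
  then have ur: "in_ran I \<psi> u" using in_ran_comb[OF on] by simp
  have uu: "l2_inner u u = 1" unfolding u_def by (rule q(2))
  have eig: "l2_inner (\<psi> i) (F u) = k * l2_inner (\<psi> i) u" if i: "i \<in> I" for i
  proof -
    have "F u = (\<lambda>x. \<Sum>j\<in>I. (q * v j) * F (\<psi> j) x)"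
      by (intro ext) (simp add: F_def u_def u0_def sum_distrib_left mult_ac)
    then have "l2_inner (\<psi> i) (F u) = (\<Sum>j\<in>I. (q * v j) * l2_inner (\<psi> i) (F (\<psi> j)))"
      using l2_inner_comb_right[of "\<psi> i" I "\<lambda>j. F (\<psi> j)"] o F2 i by simp
    also have "\<dots> = q * (\<Sum>j<Suc n. l2_inner (\<psi> i) (F (\<psi> j)) * v j)"
      unfolding I_def sum_distrib_left by (simp only: mult_ac)
    also have "\<dots> = k * (q * v i)"
      using v(3)[of i] i by (simp only: I_def lessThan_iff mult_ac)
    also have "q * v i = l2_inner (\<psi> i) u"
      unfolding u_def using i by (simp add: l2_inner_cmult_right o u02 u0i)
    finally show ?thesis .
  qed
  have eig_ran: "l2_inner \<phi> (F u) = k * l2_inner \<phi> u" if "in_ran I \<psi> \<phi>" for \<phi>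
    unfolding inner_in_ran_left[OF that on F2[OF u2]] inner_in_ran_left[OF that on u2] sum_distrib_left
    by (intro sum.cong) (simp_all add: eig)
  have nI: "n \<in> I" by (simp add: I_def)
  obtain \<psi>1 \<beta> where 1: "onf I \<psi>1" "kern I \<psi>1 = kern I \<psi>" "cmod \<beta> = 1" "\<psi>1 n = (\<lambda>x. \<beta> * u x)"
    using onf_complete[OF on nI ur uu] .
  have sub: "{..<n} \<subseteq> I" by (auto simp: I_def)
  obtain \<psi>2 where 2: "onf {..<n} \<psi>2" "kern {..<n} \<psi>2 = kern {..<n} \<psi>1"
    "\<forall>i<n. \<forall>j<n. i \<noteq> j \<longrightarrow> l2_inner (\<psi>2 i) (F (\<psi>2 j)) = 0"
    using Suc.IH[OF onf_subset[OF 1(1) sub]] unfolding F_def by blast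
  define \<psi>3 where "\<psi>3 i = (if i \<in> {..<n} then \<psi>2 i else \<psi>1 i)" for i
  have 3: "onf I \<psi>3" "kern I \<psi>3 = kern I \<psi>1"
    using onf_replace[OF 1(1) sub 2(1,2)] unfolding \<psi>3_def by auto
  have last3: "\<psi>3 n = (\<lambda>x. \<beta> * u x)" by (simp add: \<psi>3_def 1(4))
  have in0: "l2_inner (\<psi>3 i) (F (\<psi>3 n)) = 0" if "i < n" for i
  proof -
    have i: "i \<in> I" "i \<noteq> n" using that by (auto simp: I_def)
    have l: "in_l2 (\<psi>3 i)" using onfD(2)[OF 3(1) i(1)] .
    have "in_ran I \<psi>3 (\<psi>3 i)" by (rule in_ran_member[OF 3(1) i(1)])
    then have r: "in_ran I \<psi> (\<psi>3 i)"
      by (rule in_ran_cong[OF 3(1) on, rotated]) (simp add: 3(2) 1(2))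
    have "\<beta> * l2_inner (\<psi>3 i) u = l2_inner (\<psi>3 i) (\<psi>3 n)"
      by (simp add: last3 l2_inner_cmult_right l u2)
    also have "\<dots> = 0" by (rule onfD(4)[OF 3(1) i(1) nI i(2)])
    finally have z: "l2_inner (\<psi>3 i) u = 0" using 1(3) by auto
    have "F (\<psi>3 n) = (\<lambda>x. \<beta> * F u x)" by (intro ext) (simp add: F_def last3 mult_ac)
    then show ?thesis
      using eig_ran[OF r] z by (simp add: l2_inner_cmult_right l F2 u2)
  qed
  have ni0: "l2_inner (\<psi>3 n) (F (\<psi>3 i)) = 0" if "i < n" for i
    using l2_inner_cnj[of "\<psi>3 i" "F (\<psi>3 n)"] in0[OF that] by (simp add: Fs)
  have "l2_inner (\<psi>3 i) (F (\<psi>3 j)) = 0" if ij: "i < Suc n" "j < Suc n" "i \<noteq> j" for i j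
  proof -
    consider "i < n" "j < n" | "i < n" "j = n" | "i = n" "j < n" using ij by linarith
    then show ?thesis
    proof cases
      case 1
      then show ?thesis using 2(3) ij(3) by (simp add: \<psi>3_def)
    qed (use in0 ni0 in auto)
  qed
  then show ?case
    using 3 unfolding 1(2) unfolding I_def F_def by blast
qed

text \<open>Both inclusions are recorded: the \<open>e i\<close> are combinations of the
  \<open>b j\<close>, hence fixed by the projection, and the \<open>b i\<close> lie in the span of
  the \<open>e j\<close>, hence so do the columns of the projection kernel.\<close>

lemma gram_schmidt_onf:
  fixes b :: "nat \<Rightarrow> 'd::finite wave"
  assumes "\<And>i. i < n \<Longrightarrow> in_l2 (b i)"
    and "\<And>c. (\<lambda>x. \<Sum>i<n. c i * b i x) = (\<lambda>x. 0) \<Longrightarrow> \<forall>i<n. c i = 0"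
  shows "\<exists>e. onf {..<n} e \<and> (\<forall>i<n. \<exists>a. \<forall>x. e i x = (\<Sum>j<n. a j * b j x)) \<and> (\<forall>i<n. in_ran {..<n} e (b i))"
  using assms
proof (induction n)
  case 0
  then show ?case by (auto simp: onf_def)
next
  case (Suc n)
  have "\<forall>i<n. c i = 0" if "(\<lambda>x. \<Sum>i<n. c i * b i x) = (\<lambda>x. 0)" for c
  proof -
    have "(\<lambda>x. \<Sum>i<Suc n. (c(n := 0)) i * b i x) = (\<lambda>x. \<Sum>i<n. c i * b i x)"
      by (intro ext) simp
    then have "\<forall>i<Suc n. (c(n := 0)) i = 0" using that Suc.prems(2) by metis
    then show ?thesis by (metis fun_upd_apply less_Suc_eq nat_neq_iff)
  qed
  then obtain e where e: "onf {..<n} e" "\<forall>i<n. \<exists>a. \<forall>x. e i x = (\<Sum>j<n. a j * b j x)"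
    "\<forall>i<n. in_ran {..<n} e (b i)"
    using Suc.IH Suc.prems(1) less_SucI by blast
  obtain a where a: "\<And>i x. i < n \<Longrightarrow> e i x = (\<Sum>j<n. a i j * b j x)"
    using e(2) by metis
  note o = onfD[OF e(1)]
  define t where "t i = l2_inner (e i) (b n)" for i
  define v where "v x = b n x - (\<Sum>i<n. t i * e i x)" for x
  have bn: "in_l2 (b n)" using Suc.prems(1) by simp
  have s2: "in_l2 (\<lambda>x. \<Sum>i<n. t i * e i x)" by (rule in_l2_comb) (use o in auto)
  have v2: "in_l2 v" unfolding v_def by (rule in_l2_diff[OF bn s2])
  \<comment> \<open>Coordinates of \<open>v\<close> in the family \<open>b\<close>. The coefficient
    1 at \<open>n\<close> lets linear independence rule out \<open>v = 0\<close>.\<close>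
  define s where "s j = (if j = n then 1 else - (\<Sum>i<n. t i * a i j))" for j
  have vb: "v x = (\<Sum>j<Suc n. s j * b j x)" for x
  proof -
    have "(\<Sum>i<n. t i * e i x) = (\<Sum>i<n. \<Sum>j<n. t i * a i j * b j x)"
      by (intro sum.cong) (simp_all add: a sum_distrib_left mult_ac)
    also have "\<dots> = (\<Sum>j<n. \<Sum>i<n. t i * a i j * b j x)" by (rule sum.swap)
    also have "\<dots> = - (\<Sum>j<n. s j * b j x)"
      unfolding sum_negf[symmetric] by (intro sum.cong) (simp_all add: s_def sum_distrib_right)
    finally show ?thesis by (simp add: v_def s_def)
  qed
  have "v \<noteq> (\<lambda>x. 0)"
  proof
    assume "v = (\<lambda>x. 0)"
    then have "(\<lambda>x. \<Sum>j<Suc n. s j * b j x) = (\<lambda>x. 0)" by (simp only: vb[symmetric])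
    then have "s n = 0" using Suc.prems(2)[of s] by blast
    then show False by (simp add: s_def)
  qed
  then obtain q where q: "q \<noteq> 0" "l2_inner (\<lambda>x. q * v x) (\<lambda>x. q * v x) = 1"
    using l2_normalize[OF v2] by blast
  define e' where "e' = e(n := (\<lambda>x. q * v x))"
  have ev: "l2_inner (e i) v = 0" if "i < n" for i
  proof -
    have "l2_inner (e i) v = l2_inner (e i) (b n) - l2_inner (e i) (\<lambda>x. \<Sum>i<n. t i * e i x)"
      unfolding v_def using that by (intro l2_inner_diff_right bn s2 o) simp
    then show ?thesis
      using that l2_inner_comb_member[OF e(1), of i t] by (simp add: t_def[of i])
  qed
  have evq: "l2_inner (e i) (\<lambda>x. q * v x) = 0" if "i < n" for i
    using that ev by (simp add: l2_inner_cmult_right o v2)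
  have qve: "l2_inner (\<lambda>x. q * v x) (e i) = 0" if "i < n" for i
    using evq[OF that] l2_inner_cnj[of "e i" "\<lambda>x. q * v x"] by simp
  have on': "onf {..<Suc n} e'"
    unfolding onf_def e'_def using o q(2) evq qve in_l2_cmult[OF v2, of q]
    by (auto simp: less_Suc_eq)
  have "\<exists>a. \<forall>x. e' i x = (\<Sum>j<Suc n. a j * b j x)" if "i < Suc n" for i
  proof (cases "i = n")
    case True
    then show ?thesis
      by (intro exI[of _ "\<lambda>j. q * s j"]) (simp add: e'_def vb sum_distrib_left algebra_simps)
  next
    case False
    then show ?thesis
      using that by (intro exI[of _ "(a i)(n := 0)"]) (auto simp: e'_def a)
  qed
  moreover have "in_ran {..<Suc n} e' (b i)" if "i < Suc n" for i
  proof -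
    define c where "c = (if i = n then t(n := 1 / q) else (\<lambda>k. l2_inner (e k) (b i))(n := 0))"
    have "b i x = (\<Sum>k<Suc n. c k * e' k x)" for x
    proof (cases "i = n")
      case True
      have "b n x = v x + (\<Sum>k<n. t k * e k x)" by (simp add: v_def)
      then show ?thesis using True q(1) by (simp add: c_def e'_def)
    next
      case False
      then have "in_ran {..<n} e (b i)" using e(3) that by simp
      then have "b i x = (\<Sum>k<n. l2_inner (e k) (b i) * e k x)" unfolding in_ran_def by blast
      then show ?thesis using False by (simp add: c_def e'_def)
    qed
    then have "b i = (\<lambda>x. \<Sum>k<Suc n. c k * e' k x)" by blast
    then show ?thesis using in_ran_comb[OF on', of c] by metis
  qed
  ultimately show ?case using on' by blast
qed

lemma in_ran_linear:
  assumes "onf I e" "\<And>i. i \<in> J \<Longrightarrow> in_ran I e (b i)"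
  shows "in_ran I e (\<lambda>x. \<Sum>i\<in>J. c i * b i x)"
proof -
  have "(\<Sum>i\<in>J. c i * b i x) = (\<Sum>k\<in>I. (\<Sum>i\<in>J. c i * l2_inner (e k) (b i)) * e k x)" for x
  proof -
    have "(\<Sum>i\<in>J. c i * b i x) = (\<Sum>i\<in>J. \<Sum>k\<in>I. c i * l2_inner (e k) (b i) * e k x)"
    proof (intro sum.cong refl)
      fix i assume "i \<in> J"
      then have "b i x = (\<Sum>k\<in>I. l2_inner (e k) (b i) * e k x)"
        using assms(2) unfolding in_ran_def by blast
      then have "c i * b i x = c i * (\<Sum>k\<in>I. l2_inner (e k) (b i) * e k x)" by (rule arg_cong)
      then show "c i * b i x = (\<Sum>k\<in>I. c i * l2_inner (e k) (b i) * e k x)"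
        by (simp only: sum_distrib_left mult.assoc)
    qed
    also have "\<dots> = (\<Sum>k\<in>I. \<Sum>i\<in>J. c i * l2_inner (e k) (b i) * e k x)" by (rule sum.swap)
    finally show ?thesis by (simp only: sum_distrib_right)
  qed
  then show ?thesis using in_ran_comb[OF assms(1)] by presburger
qed

text \<open>The column at \<open>y\<close> is the image of \<open>delta y\<close>, so it expands in
  \<open>e\<close>. Self-adjointness moves \<open>P\<close> onto \<open>e i\<close>, which it fixes,
  and the coefficient becomes \<open>cnj (e i y)\<close>.\<close>

lemma rank_orth_proj_onf:
  assumes "rank_orth_proj m P"
  obtains e where "onf {..<m} e" "P = kern {..<m} e"
proof -
  have proj: "is_orth_proj P" and "has_rank P m" using assms by (auto simp: rank_orth_proj_def)
  then obtain b where ind: "\<And>c. (\<lambda>x. \<Sum>i<m. c i * b i x) = (\<lambda>x. 0) \<Longrightarrow> \<forall>i<m. c i = 0"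
    and ran: "{ker_apply P \<psi> | \<psi>. in_l2 \<psi>} = {(\<lambda>x. \<Sum>i<m. c i * b i x) | c. True}"
    unfolding has_rank_def by blast
  have P2: "in_l2 (ker_apply P \<psi>)" and PP: "ker_apply P (ker_apply P \<psi>) = ker_apply P \<psi>"
    and Ps: "in_l2 \<phi> \<Longrightarrow> l2_inner \<psi> (ker_apply P \<phi>) = l2_inner (ker_apply P \<psi>) \<phi>"
    if "in_l2 \<psi>" for \<psi> \<phi>
    using proj that unfolding is_orth_proj_def by blast+
  have comb: "\<exists>\<psi>. in_l2 \<psi> \<and> (\<lambda>x. \<Sum>i<m. c i * b i x) = ker_apply P \<psi>" for c
    using ran by blast
  have b2: "in_l2 (b i)" if "i < m" for i
  proof -
    have "(\<lambda>x. \<Sum>k<m. (if k = i then 1 else 0) * b k x) = b i"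
      using that by (simp add: if_distrib if_distribR cong: if_cong)
    then show ?thesis using comb[of "\<lambda>k. if k = i then 1 else 0"] P2 by force
  qed
  obtain e where e: "onf {..<m} e" "\<forall>i<m. \<exists>a. \<forall>x. e i x = (\<Sum>j<m. a j * b j x)"
    "\<forall>i<m. in_ran {..<m} e (b i)"
    using gram_schmidt_onf[of m b, OF b2 ind] by blast
  have fixe: "ker_apply P (e i) = e i" if i: "i < m" for i
  proof -
    obtain a where "\<And>x. e i x = (\<Sum>j<m. a j * b j x)" using e(2) i by blast
    then have "e i = (\<lambda>x. \<Sum>j<m. a j * b j x)" by blast
    then show ?thesis using comb[of a] PP by metis
  qed
  have "P x y = kern {..<m} e x y" for x y
  proof -
    have col: "ker_apply P (delta y) = (\<lambda>x. P x y)"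
      unfolding ker_apply_def by (intro ext infsumI has_sum_delta)
    have "ker_apply P (delta y) \<in> {ker_apply P \<psi> | \<psi>. in_l2 \<psi>}"
      using in_l2_delta[of y] by blast
    then have "(\<lambda>x. P x y) \<in> {(\<lambda>x. \<Sum>i<m. c i * b i x) | c. True}" unfolding ran col .
    then obtain c where c: "(\<lambda>x. P x y) = (\<lambda>x. \<Sum>i<m. c i * b i x)"
      unfolding mem_Collect_eq by blast
    have "in_ran {..<m} e (\<lambda>x. P x y)"
      unfolding c by (rule in_ran_linear[OF e(1)]) (use e(3) in auto)
    then have "P x y = (\<Sum>i<m. l2_inner (e i) (\<lambda>x. P x y) * e i x)"
      unfolding in_ran_def by blast
    also have "\<dots> = (\<Sum>i<m. cnj (e i y) * e i x)"
    proof (intro sum.cong refl)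
      fix i assume i: "i \<in> {..<m}"
      have "l2_inner (e i) (\<lambda>x. P x y) = l2_inner (ker_apply P (e i)) (delta y)"
        unfolding col[symmetric] using i by (intro Ps onfD(2)[OF e(1)] in_l2_delta)
      also have "\<dots> = cnj (e i y)" using fixe i by (simp add: l2_inner_delta)
      finally show "l2_inner (e i) (\<lambda>x. P x y) * e i x = cnj (e i y) * e i x" by simp
    qed
    finally show ?thesis by (simp add: kern_def mult.commute)
  qed
  then show ?thesis using e(1) by (intro that) auto
qed

section \<open>Lattice geometry\<close>

lemma linf_le_iff: "linf_dist x y \<le> r \<longleftrightarrow> (\<forall>i. real_of_int \<bar>vec_nth x i - vec_nth y i\<bar> \<le> r)"
  unfolding linf_dist_def by (subst Max_le_iff) auto

lemma linf_ge: "real_of_int \<bar>vec_nth x i - vec_nth y i\<bar> \<le> linf_dist x y"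
  using linf_le_iff[of x y "linf_dist x y"] by auto

lemma linf_nonneg: "0 \<le> linf_dist x y"
  using linf_ge[of x undefined y] by (meson abs_ge_zero of_int_0_le_iff order_trans)

lemma linf_commute: "linf_dist x y = linf_dist y x"
  by (simp add: linf_dist_def abs_minus_commute)

lemma linf_self [simp]: "linf_dist x x = 0"
  by (simp add: linf_dist_def)

lemma linf_triangle: "linf_dist x z \<le> linf_dist x y + linf_dist y z"
  unfolding linf_le_iff
proof
  fix i
  have "real_of_int \<bar>vec_nth x i - vec_nth z i\<bar> \<le> real_of_int \<bar>vec_nth x i - vec_nth y i\<bar> + real_of_int \<bar>vec_nth y i - vec_nth z i\<bar>"
    by linarith
  then show "real_of_int \<bar>vec_nth x i - vec_nth z i\<bar> \<le> linf_dist x y + linf_dist y z"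
    using linf_ge[of x i y] linf_ge[of y i z] by linarith
qed

definition lball :: "'d::finite lat \<Rightarrow> real \<Rightarrow> 'd lat set" where
  "lball z r = {x. linf_dist x z \<le> r}"

lemma lball_subset:
  "lball z r \<subseteq> vec_lambda ` (PiE UNIV (\<lambda>i. {vec_nth z i - \<lfloor>r\<rfloor>..vec_nth z i + \<lfloor>r\<rfloor>}))"
proof
  fix x assume "x \<in> lball z r"
  then have "\<bar>vec_nth x i - vec_nth z i\<bar> \<le> \<lfloor>r\<rfloor>" for i
    by (simp add: lball_def linf_le_iff le_floor_iff)
  then have "vec_nth x i \<in> {vec_nth z i - \<lfloor>r\<rfloor>..vec_nth z i + \<lfloor>r\<rfloor>}" for i
    by (simp add: abs_le_iff) (smt (verit))
  then have "vec_nth x \<in> PiE UNIV (\<lambda>i. {vec_nth z i - \<lfloor>r\<rfloor>..vec_nth z i + \<lfloor>r\<rfloor>})" by auto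
  then show "x \<in> vec_lambda ` (PiE UNIV (\<lambda>i. {vec_nth z i - \<lfloor>r\<rfloor>..vec_nth z i + \<lfloor>r\<rfloor>}))"
    by (intro image_eqI[where x = "vec_nth x"]) simp_all
qed

lemma finite_lball: "finite (lball z r)"
  by (rule finite_subset[OF lball_subset]) (intro finite_imageI finite_PiE, auto)

lemma card_lball:
  fixes z :: "'d::finite lat"
  assumes "r \<ge> 0"
  shows "real (card (lball z r)) \<le> (2 * r + 1) ^ CARD('d)"
proof -
  define P where "P = PiE UNIV (\<lambda>i. {vec_nth z i - \<lfloor>r\<rfloor>..vec_nth z i + \<lfloor>r\<rfloor>})"
  have fP: "finite P" unfolding P_def by (intro finite_PiE) auto
  have "card (lball z r) \<le> card (vec_lambda ` P)"
    unfolding P_def by (intro card_mono lball_subset) (use fP in \<open>auto simp: P_def\<close>)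
  also have "\<dots> \<le> card P" by (rule card_image_le[OF fP])
  also have "card P = nat (2 * \<lfloor>r\<rfloor> + 1) ^ CARD('d)"
    unfolding P_def by (simp add: card_PiE)
  finally have "real (card (lball z r)) \<le> real (nat (2 * \<lfloor>r\<rfloor> + 1) ^ CARD('d))" by linarith
  also have "\<dots> = real (nat (2 * \<lfloor>r\<rfloor> + 1)) ^ CARD('d)" by simp
  also have "\<dots> \<le> (2 * r + 1) ^ CARD('d)"
    by (intro power_mono) (use assms in \<open>linarith+\<close>)
  finally show ?thesis .
qed

section \<open>Uniform summability of exponentials on the lattice\<close>

lemma power_le_fact_exp:
  assumes "(x::real) \<ge> 0"
  shows "x ^ n \<le> fact n * exp x"
proof -
  have "(\<Sum>k\<in>{n}. x ^ k /\<^sub>R fact k) \<le> (\<Sum>k. x ^ k /\<^sub>R fact k)"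
    using assms by (intro sum_le_suminf summable_exp_generic) auto
  then show ?thesis by (simp add: exp_def field_simps)
qed

text \<open>Sum over shells of unit width: the polynomial number of points in a shell is absorbed by
  half of the exponential, and the remaining geometric series does not depend on the center.\<close>

lemma exp_linf_summable:
  fixes a :: real
  assumes "a > 0"
  obtains S where "S > 0"
    "\<And>z::'d::finite lat. (\<lambda>x. exp (- (a * linf_dist x z))) summable_on UNIV"
    "\<And>z::'d::finite lat. (\<Sum>\<^sub>\<infinity>x. exp (- (a * linf_dist x z))) \<le> S"
proof -
  define d where "d = CARD('d)"
  define C where "C = (4 / a) ^ d * fact d * exp (3 * a / 4)"
  define q where "q = exp (- a / 2)"
  have q: "0 < q" "q < 1" using assms by (auto simp: q_def)
  have C0: "C > 0" using assms by (simp add: C_def)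
  have trm: "(2 * real k + 3) ^ d * exp (- (a * real k)) \<le> C * q ^ k" for k
  proof -
    \<comment> \<open>Scaled so that \<open>exp y\<close> equals \<open>exp (a * real k / 2)\<close>
      up to a constant factor.\<close>
    define y where "y = (a / 4) * (2 * real k + 3)"
    have "(2 * real k + 3) = (4 / a) * y" using assms by (simp add: y_def)
    then have "(2 * real k + 3) ^ d = (4 / a) ^ d * y ^ d" by (simp only: power_mult_distrib)
    also have "\<dots> \<le> (4 / a) ^ d * (fact d * exp y)"
      by (intro mult_left_mono power_le_fact_exp) (use assms in \<open>auto simp: y_def\<close>)
    finally have "(2 * real k + 3) ^ d * exp (- (a * real k)) \<le> (4 / a) ^ d * (fact d * exp y) * exp (- (a * real k))"
      by (rule mult_right_mono) simp
    also have "\<dots> = C * (exp (a * real k / 2) * exp (- (a * real k)))"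
      by (simp add: C_def y_def distrib_left exp_add mult_ac)
    also have "exp (a * real k / 2) * exp (- (a * real k)) = q ^ k"
      unfolding q_def exp_of_nat_mult[symmetric] exp_add[symmetric] by (simp add: field_simps)
    finally show ?thesis .
  qed
  have sq: "summable (\<lambda>k. C * q ^ k)" using q by (intro summable_mult summable_geometric) simp
  define S where "S = (\<Sum>k. C * q ^ k)"
  have S0: "S > 0" unfolding S_def using q C0 by (intro suminf_pos sq) auto
  have fin: "(\<Sum>x\<in>F. exp (- (a * linf_dist x z))) \<le> S" if F: "finite F" for F and z :: "'d lat"
  proof -
    define n where "n x = nat \<lfloor>linf_dist x z\<rfloor>" for x
    have n1: "real (n x) \<le> linf_dist x z" "linf_dist x z \<le> real (n x) + 1" for x
      using linf_nonneg[of x z] by (auto simp: n_def)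
    have "(\<Sum>x\<in>F. exp (- (a * linf_dist x z))) \<le> (\<Sum>x\<in>F. exp (- (a * real (n x))))"
      using n1 assms by (intro sum_mono) simp
    also have "\<dots> = (\<Sum>k\<in>n ` F. \<Sum>x\<in>{x\<in>F. n x = k}. exp (- (a * real (n x))))"
      by (rule sum.image_gen[OF F])
    also have "\<dots> \<le> (\<Sum>k\<in>n ` F. C * q ^ k)"
    proof (rule sum_mono)
      fix k
      have "(\<Sum>x\<in>{x\<in>F. n x = k}. exp (- (a * real (n x)))) = real (card {x\<in>F. n x = k}) * exp (- (a * real k))"
        by simp
      also have "\<dots> \<le> real (card (lball z (real k + 1))) * exp (- (a * real k))"
        using n1(2) by (intro mult_right_mono of_nat_mono card_mono finite_lball) (auto simp: lball_def)
      also have "\<dots> \<le> (2 * real k + 3) ^ d * exp (- (a * real k))"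
        using card_lball[of "real k + 1" z] by (intro mult_right_mono) (auto simp: d_def algebra_simps)
      finally show "(\<Sum>x\<in>{x\<in>F. n x = k}. exp (- (a * real (n x)))) \<le> C * q ^ k"
        using trm[of k] by linarith
    qed
    also have "\<dots> \<le> S"
      unfolding S_def using F q C0 by (intro sum_le_suminf sq) auto
    finally show ?thesis .
  qed
  have summ: "(\<lambda>x. exp (- (a * linf_dist x z))) summable_on UNIV" for z :: "'d lat"
    by (rule nonneg_bdd_above_summable_on) (use fin in \<open>auto intro!: bdd_aboveI[of _ S]\<close>)
  show ?thesis
    by (rule that[OF S0 summ]) (intro infsum_le_finite_sums summ fin)
qed

text \<open>Maximum principle for \<open>g\<close> times an exponential weight; the weight is truncated so that the
  supremum is finite.\<close>

lemma decay_off_set: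
  fixes g dd :: "'d::finite lat \<Rightarrow> real"
  assumes \<kappa>: "\<kappa> \<ge> 0" and B: "B \<ge> 0" and \<epsilon>: "\<epsilon> \<ge> 0" "\<epsilon> * S \<le> 1 / 2"
    and S: "\<And>z::'d lat. (\<lambda>x. exp (- (\<kappa> * linf_dist x z))) summable_on UNIV"
      "\<And>z::'d lat. (\<Sum>\<^sub>\<infinity>x. exp (- (\<kappa> * linf_dist x z))) \<le> S"
    and g: "\<And>x. 0 \<le> g x" "\<And>x. g x \<le> G"
    and dd: "\<And>x. 0 \<le> dd x" "\<And>x y. dd y \<le> dd x + linf_dist x y"
    and inside: "\<And>y. y \<in> A \<Longrightarrow> g y \<le> B * exp (- (\<kappa> * dd y))"
    and outside: "\<And>y. y \<notin> A \<Longrightarrow> g y \<le> (\<Sum>\<^sub>\<infinity>x. \<epsilon> * exp (- (2 * \<kappa> * linf_dist x y)) * g x)"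
  shows "g y \<le> B * exp (- (\<kappa> * dd y))"
proof -
  \<comment> \<open>Truncating at the value of \<open>dd\<close> at \<open>y\<close> bounds the
    weight everywhere and leaves it intact at \<open>y\<close>.\<close>
  define T where "T = dd y"
  have T: "T \<ge> 0" by (simp add: T_def dd)
  define w where "w x = exp (\<kappa> * min (dd x) T)" for x
  have w0: "w x > 0" for x by (simp add: w_def)
  have wLip: "w y \<le> w x * exp (\<kappa> * linf_dist x y)" for x y
  proof -
    have "min (dd y) T \<le> min (dd x) T + linf_dist x y"
      using dd(2)[of y x] linf_nonneg[of x y] by linarith
    then show ?thesis
      unfolding w_def exp_add[symmetric] using \<kappa>
      by (simp add: distrib_left[symmetric] mult_left_mono)
  qed
  define h where "h x = g x * w x" for x
  have hG: "h x \<le> G * exp (\<kappa> * T)" for x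
  proof -
    have "w x \<le> exp (\<kappa> * T)" using \<kappa> by (simp add: w_def mult_left_mono)
    moreover have "0 \<le> G" using g[of x] by linarith
    ultimately show ?thesis unfolding h_def using g[of x] w0[of x] by (intro mult_mono) auto
  qed
  have bdd: "bdd_above (range h)" using hG by (auto intro!: bdd_aboveI)
  define W where "W = (SUP x. h x)"
  have hW: "h x \<le> W" for x unfolding W_def by (rule cSUP_upper[OF _ bdd]) simp
  have h0: "h x \<ge> 0" for x using g(1) w0[of x] by (simp add: h_def)
  have W0: "W \<ge> 0" using hW[of y] h0[of y] by linarith
  \<comment> \<open>Off \<open>A\<close>, half of the kernel's rate \<open>2 * \<kappa>\<close> pays
    for the variation of the weight and the other half for summation. For a finite supremum
    \<open>W\<close>, the bound \<open>W \<le> max B (W / 2)\<close> forces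
    \<open>W \<le> B\<close>.\<close>
  have "h z \<le> max B (W / 2)" for z
  proof (cases "z \<in> A")
    case True
    have "h z \<le> (B * exp (- (\<kappa> * dd z))) * w z"
      unfolding h_def using inside[OF True] w0[of z] by (intro mult_right_mono) auto
    also have "\<dots> = B * exp (\<kappa> * (min (dd z) T - dd z))"
      by (simp add: w_def exp_add[symmetric] algebra_simps)
    also have "\<dots> \<le> B * 1"
      using B \<kappa> by (intro mult_left_mono) (auto simp: mult_nonneg_nonpos)
    finally show ?thesis by simp
  next
    case False
    have pt: "\<epsilon> * exp (- (2 * \<kappa> * linf_dist x z)) * g x * w z \<le> \<epsilon> * W * exp (- (\<kappa> * linf_dist x z))" for x
    proof -
      have "\<epsilon> * exp (- (2 * \<kappa> * linf_dist x z)) * g x * w z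
          \<le> \<epsilon> * exp (- (2 * \<kappa> * linf_dist x z)) * g x * (w x * exp (\<kappa> * linf_dist x z))"
        using wLip[of z x] \<epsilon> g(1) by (intro mult_left_mono) auto
      also have "\<dots> = \<epsilon> * (exp (- (2 * \<kappa> * linf_dist x z)) * exp (\<kappa> * linf_dist x z)) * h x"
        by (simp add: h_def mult_ac)
      also have "exp (- (2 * \<kappa> * linf_dist x z)) * exp (\<kappa> * linf_dist x z) = exp (- (\<kappa> * linf_dist x z))"
        by (simp add: exp_add[symmetric] algebra_simps)
      also have "\<epsilon> * exp (- (\<kappa> * linf_dist x z)) * h x \<le> \<epsilon> * exp (- (\<kappa> * linf_dist x z)) * W"
        using hW[of x] \<epsilon> by (intro mult_left_mono) auto
      finally show ?thesis by (simp add: mult_ac)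
    qed
    have s1: "(\<lambda>x. \<epsilon> * W * exp (- (\<kappa> * linf_dist x z))) summable_on UNIV"
      by (intro summable_on_cmult_right S)
    have s2: "(\<lambda>x. \<epsilon> * exp (- (2 * \<kappa> * linf_dist x z)) * g x * w z) summable_on UNIV"
      using \<epsilon> g(1) w0[of z] by (intro summable_on_comparison_test[OF s1] pt) (simp add: less_imp_le)
    have "h z \<le> (\<Sum>\<^sub>\<infinity>x. \<epsilon> * exp (- (2 * \<kappa> * linf_dist x z)) * g x) * w z"
      unfolding h_def using outside[OF False] w0[of z] by (intro mult_right_mono) auto
    also have "\<dots> = (\<Sum>\<^sub>\<infinity>x. \<epsilon> * exp (- (2 * \<kappa> * linf_dist x z)) * g x * w z)"
      by (rule infsum_cmult_left'[symmetric])
    also have "\<dots> \<le> (\<Sum>\<^sub>\<infinity>x. \<epsilon> * W * exp (- (\<kappa> * linf_dist x z)))"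
      by (rule infsum_mono[OF s2 s1]) (rule pt)
    also have "\<dots> = \<epsilon> * W * (\<Sum>\<^sub>\<infinity>x. exp (- (\<kappa> * linf_dist x z)))"
      by (rule infsum_cmult_right')
    also have "\<dots> \<le> \<epsilon> * W * S"
      using S(2)[of z] \<epsilon> W0 by (intro mult_left_mono) auto
    also have "\<dots> = (\<epsilon> * S) * W" by simp
    also have "\<dots> \<le> 1 / 2 * W" using \<epsilon>(2) W0 by (rule mult_right_mono)
    finally show ?thesis by simp
  qed
  then have "W \<le> max B (W / 2)" unfolding W_def by (intro cSUP_least) auto
  then have "W \<le> B" using W0 B by linarith
  then have "g y * exp (\<kappa> * dd y) \<le> B" using hW[of y] by (simp add: h_def w_def T_def)
  then show ?thesis by (simp add: exp_minus field_simps)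
qed

section \<open>Distance to a finite set and clusters of points\<close>

definition dset :: "'d::finite lat set \<Rightarrow> 'd lat \<Rightarrow> real" where
  "dset Z y = Min (linf_dist y ` Z)"

lemma dset_le: "finite Z \<Longrightarrow> z \<in> Z \<Longrightarrow> dset Z y \<le> linf_dist y z"
  by (simp add: dset_def)

lemma dset_attained:
  assumes "finite Z" "Z \<noteq> {}"
  obtains z where "z \<in> Z" "dset Z y = linf_dist y z"
proof -
  have "dset Z y \<in> linf_dist y ` Z" unfolding dset_def using assms by (intro Min_in) auto
  then show ?thesis using that by blast
qed

lemma dset_nonneg: "finite Z \<Longrightarrow> Z \<noteq> {} \<Longrightarrow> 0 \<le> dset Z y"
  by (metis dset_attained linf_nonneg)

lemma dset_Lipschitz: 
  assumes "finite Z" "Z \<noteq> {}"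
  shows "dset Z y \<le> dset Z x + linf_dist x y"
proof -
  obtain z where "z \<in> Z" "dset Z x = linf_dist x z" by (rule dset_attained[OF assms])
  then show ?thesis
    using dset_le[OF assms(1), of z y] linf_triangle[of y z x] by (simp add: linf_commute)
qed

text \<open>Among the \<open>card Z\<close> shells of width \<open>L\<close> around a point of \<open>Z\<close> one contains no point of \<open>Z\<close>; the
  points inside that shell form a cluster that can be split off.\<close>

lemma cluster_labels:
  fixes Z :: "'d::finite lat set" and L :: real
  assumes "finite Z" "L > 0"
  shows "\<exists>f :: 'd lat \<Rightarrow> nat. (\<forall>z\<in>Z. f z < card Z) \<and>
    (\<forall>z\<in>Z. \<forall>z'\<in>Z. (f z = f z' \<longrightarrow> linf_dist z z' \<le> 2 * card Z * L) \<and> (f z \<noteq> f z' \<longrightarrow> linf_dist z z' > L))"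
  using assms(1)
proof (induction Z rule: finite_psubset_induct)
  case (psubset Z)
  show ?case
  proof (cases "Z = {}")
    case False
    then obtain z0 where z0: "z0 \<in> Z" by blast
    define n where "n = card Z"
    \<comment> \<open>The point \<open>z0\<close> lies in none of the \<open>n\<close> disjoint
      shells, so at most \<open>n - 1\<close> points are left to fill them.\<close>
    have "\<exists>k<n. \<forall>z\<in>Z. linf_dist z z0 \<le> k * L \<or> linf_dist z z0 > (real k + 1) * L"
    proof (rule ccontr)
      assume "\<not> ?thesis"
      then have "\<forall>k<n. \<exists>z\<in>Z. k * L < linf_dist z z0 \<and> linf_dist z z0 \<le> (real k + 1) * L"
        by (meson not_le)
      then obtain w where w: "\<And>k. k < n \<Longrightarrow> w k \<in> Z \<and> k * L < linf_dist (w k) z0 \<and> linf_dist (w k) z0 \<le> (real k + 1) * L"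
        by metis
      have "inj_on w {..<n}"
      proof (rule linorder_inj_onI)
        fix k l assume kl: "k < l" "k \<in> {..<n}" "l \<in> {..<n}"
        have "linf_dist (w k) z0 \<le> (real k + 1) * L" using w kl by simp
        also have "\<dots> \<le> l * L" using kl assms(2) by (intro mult_right_mono) auto
        also have "\<dots> < linf_dist (w l) z0" using w kl by simp
        finally show "w k \<noteq> w l" by auto
      qed auto
      moreover have "w ` {..<n} \<subseteq> Z - {z0}"
      proof
        fix z assume "z \<in> w ` {..<n}"
        then obtain k where k: "k < n" "z = w k" by auto
        have "0 \<le> k * L" using assms(2) by simp
        then have "linf_dist (w k) z0 > 0" using w[OF k(1)] by linarith
        then show "z \<in> Z - {z0}" using w[OF k(1)] k(2) by auto
      qed
      ultimately have "card {..<n} \<le> card (Z - {z0})"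
        using psubset.hyps by (intro card_inj_on_le[of w]) auto
      moreover have "card (Z - {z0}) < n"
        unfolding n_def using z0 psubset.hyps by (intro psubset_card_mono) auto
      ultimately show False by simp
    qed
    then obtain k where k: "k < n" "\<And>z. z \<in> Z \<Longrightarrow> linf_dist z z0 \<le> k * L \<or> linf_dist z z0 > (real k + 1) * L"
      by blast
    define C where "C = {z\<in>Z. linf_dist z z0 \<le> k * L}"
    have z0C: "z0 \<in> C" using z0 assms(2) by (simp add: C_def)
    have sub: "Z - C \<subset> Z" using z0 z0C by blast
    then obtain f where f: "\<forall>z\<in>Z - C. f z < card (Z - C)"
      "\<forall>z\<in>Z - C. \<forall>z'\<in>Z - C. (f z = f z' \<longrightarrow> linf_dist z z' \<le> 2 * card (Z - C) * L) \<and> (f z \<noteq> f z' \<longrightarrow> linf_dist z z' > L)"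
      using psubset.IH by blast
    have less: "card (Z - C) < n" unfolding n_def using sub psubset.hyps by (rule psubset_card_mono[rotated])
    \<comment> \<open>The label \<open>card (Z - C)\<close> is fresh, since the induction hypothesis
      uses only smaller ones, and it is below \<open>card Z\<close> because \<open>z0\<close> is in
      \<open>C\<close>.\<close>
    define f' where "f' z = (if z \<in> C then card (Z - C) else f z)" for z
    have sep: "linf_dist z z' > L" if "z \<in> C" "z' \<in> Z - C" for z z'
    proof -
      have "linf_dist z' z0 > (real k + 1) * L" using k(2)[of z'] that by (auto simp: C_def)
      moreover have "linf_dist z z0 \<le> k * L" using that by (simp add: C_def)
      moreover have "linf_dist z' z0 \<le> linf_dist z z' + linf_dist z z0"
        using linf_triangle[of z' z0 z] by (simp add: linf_commute)
      ultimately show ?thesis by (simp add: algebra_simps)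
    qed
    have near: "linf_dist z z' \<le> 2 * n * L" if "z \<in> C" "z' \<in> C" for z z'
    proof -
      have "linf_dist z z' \<le> linf_dist z z0 + linf_dist z' z0"
        using linf_triangle[of z z' z0] by (simp add: linf_commute)
      also have "\<dots> \<le> 2 * (k * L)" using that by (simp add: C_def)
      also have "\<dots> \<le> 2 * (n * L)" using k(1) assms(2) by (intro mult_left_mono mult_right_mono) auto
      finally show ?thesis by simp
    qed
    have mono: "2 * real (card (Z - C)) * L \<le> 2 * n * L"
      using less assms(2) by (intro mult_right_mono) auto
    have "f' z < n" if "z \<in> Z" for z using f(1) less that by (force simp: f'_def)
    moreover have "(f' z = f' z' \<longrightarrow> linf_dist z z' \<le> 2 * n * L) \<and> (f' z \<noteq> f' z' \<longrightarrow> linf_dist z z' > L)"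
      if "z \<in> Z" "z' \<in> Z" for z z'
    proof -
      consider "z \<in> C" "z' \<in> C" | "z \<in> C" "z' \<in> Z - C" | "z \<in> Z - C" "z' \<in> C" | "z \<in> Z - C" "z' \<in> Z - C"
        using \<open>z \<in> Z\<close> \<open>z' \<in> Z\<close> by blast
      then show ?thesis
      proof cases
        case 1
        then show ?thesis using near by (simp add: f'_def)
      next
        case 2
        then have "f z' < card (Z - C)" using f(1) by blast
        then show ?thesis using 2 sep[OF 2] by (auto simp: f'_def)
      next
        case 3
        then have "f z < card (Z - C)" using f(1) by blast
        then show ?thesis using 3 sep[OF 3(2,1)] by (auto simp: f'_def linf_commute)
      next
        case 4
        then have "f' z = f z" "f' z' = f z'" by (auto simp: f'_def)
        moreover have "f z = f z' \<longrightarrow> linf_dist z z' \<le> 2 * card (Z - C) * L" "f z \<noteq> f z' \<longrightarrow> linf_dist z z' > L"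
          using f(2) 4 by blast+
        ultimately show ?thesis using mono by auto
      qed
    qed
    ultimately show ?thesis unfolding n_def by blast
  qed auto
qed

section \<open>Localization of the range of a projection\<close>

text \<open>To be read with \<open>\<Lambda> = - ln \<theta>\<close>. All largeness requirements are
  gathered as assumptions, so the estimates below merely compare exponents. The rate
  \<open>c / 32\<close> is the slowest one summed, and its bound \<open>S\<close> serves for all
  faster ones. The last two assumptions bound the number of points in balls of radius
  \<open>R1\<close> and \<open>R2\<close>.\<close>

locale localized_projection =
  fixes b :: "nat \<Rightarrow> 'd::finite wave" and m :: nat and c \<Lambda> S :: real
  assumes m_pos: "0 < m" and m_le: "real m \<le> exp \<Lambda>" and c_pos: "0 < c"
    and \<Lambda>_ge: "4 \<le> \<Lambda>"
    and onf_b: "onf {..<m} b"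
    and kern_decay: "\<And>x y. cmod (kern {..<m} b x y) \<le> exp (\<Lambda> - c * linf_dist x y)"
    and S_summable: "\<And>z::'d lat. (\<lambda>x. exp (- (c / 32 * linf_dist x z))) summable_on UNIV"
    and S_bound: "\<And>z::'d lat. (\<Sum>\<^sub>\<infinity>x. exp (- (c / 32 * linf_dist x z))) \<le> S"
    and S_le: "2 * S \<le> exp (\<Lambda> / 2)"
    and \<Lambda>_ball1: "(2 * (8 * \<Lambda> / c) + 1) ^ CARD('d) \<le> exp \<Lambda>"
    and \<Lambda>_ball2: "32 * (2 * (320 * \<Lambda> / c) + 1) ^ CARD('d) \<le> \<Lambda> ^ (CARD('d) + 1)"
begin

abbreviation "I \<equiv> {..<m}"

definition P :: "'d lat \<Rightarrow> 'd lat \<Rightarrow> complex" where "P = kern I b"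

definition D :: "'d lat \<Rightarrow> real" where "D x = Re (P x x)"

text \<open>Outside this set Cauchy-Schwarz gives
  \<open>cmod (P y x) \<le> exp (- 2 * \<Lambda>)\<close>, enough to beat the prefactor
  \<open>exp \<Lambda>\<close> of the kernel decay in a geometric mean.\<close>

definition A0 :: "'d lat set" where "A0 = {x. exp (- 4 * \<Lambda>) \<le> D x}"

text \<open>For \<open>r\<close> beyond \<open>R1\<close>, \<open>2 * \<Lambda> - 2 * c * r\<close>
  drops below \<open>- 6 * \<Lambda> - c * r\<close>; beyond \<open>R2\<close>,
  \<open>8 * \<Lambda> - c * r / 16\<close> drops below
  \<open>- 2 * \<Lambda> - c * r / 32\<close>.\<close>

abbreviation "R1 \<equiv> 8 * \<Lambda> / c"
abbreviation "R2 \<equiv> 320 * \<Lambda> / c"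

lemma exp_summable: 
  assumes "c / 32 \<le> a"
  shows "(\<lambda>x::'d lat. exp (- (a * linf_dist x z))) summable_on UNIV"
    "(\<Sum>\<^sub>\<infinity>x::'d lat. exp (- (a * linf_dist x z))) \<le> S"
proof -
  have le: "exp (- (a * linf_dist x z)) \<le> exp (- (c / 32 * linf_dist x z))" for x
    using mult_right_mono[OF assms linf_nonneg[of x z]] by simp
  show s: "(\<lambda>x::'d lat. exp (- (a * linf_dist x z))) summable_on UNIV"
    by (rule summable_on_comparison_test[OF S_summable[of z]]) (use le in auto)
  show "(\<Sum>\<^sub>\<infinity>x::'d lat. exp (- (a * linf_dist x z))) \<le> S"
    using infsum_mono[OF s S_summable[of z] le] S_bound[of z] by simp
qed

lemma S_nonneg: "0 \<le> S"
  using S_bound[of undefined] infsum_nonneg[of UNIV "\<lambda>x::'d lat. exp (- (c / 32 * linf_dist x undefined))"]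
  by force

lemma P_decay: "cmod (P x y) \<le> exp (\<Lambda> - c * linf_dist x y)"
  unfolding P_def by (rule kern_decay)

lemma D_eq: "D x = (\<Sum>i\<in>I. (cmod (b i x))\<^sup>2)"
  by (simp add: D_def P_def kern_diag)

lemma D_nonneg: "0 \<le> D x"
  by (simp add: D_eq sum_nonneg)

lemma P_diag: "P x x = of_real (D x)"
  unfolding D_def P_def by (rule kern_diag_of_real)

lemma P_cauchy_schwarz: "(cmod (P x y))\<^sup>2 \<le> D x * D y"
proof -
  have "cmod (P x y) \<le> (\<Sum>i\<in>I. cmod (b i x) * cmod (b i y))"
    unfolding P_def kern_def by (rule order_trans[OF norm_sum]) (simp add: norm_mult)
  then have "(cmod (P x y))\<^sup>2 \<le> (\<Sum>i\<in>I. cmod (b i x) * cmod (b i y))\<^sup>2"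
    by (rule power_mono) simp
  also have "\<dots> \<le> (\<Sum>i\<in>I. (cmod (b i x))\<^sup>2) * (\<Sum>i\<in>I. (cmod (b i y))\<^sup>2)"
    by (rule Cauchy_Schwarz_ineq_sum)
  finally show ?thesis by (simp add: D_eq)
qed

lemma column_l2: "in_l2 (\<lambda>y. P y x)"
  using in_ran_l2[OF in_ran_column[OF onf_b, of 1 x]] by (simp add: P_def)

lemma has_sum_column: "((\<lambda>y. (cmod (P y x))\<^sup>2) has_sum D x) UNIV"
  using has_sum_norm_sq[OF column_l2[of x]] l2_inner_column[OF onf_b, of x] by (simp add: P_def D_def)

lemma D_le_one: "D x \<le> 1"
proof -
  have "(D x)\<^sup>2 \<le> D x"
    using finite_sum_le_has_sum[OF has_sum_column[of x], of "{x}"] by (simp add: P_diag)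
  then show ?thesis
    using D_nonneg[of x] by (cases "D x = 0") (auto simp: power2_eq_square)
qed

lemma has_sum_P: "in_ran I b \<phi> \<Longrightarrow> ((\<lambda>x. P y x * \<phi> x) has_sum \<phi> y) UNIV"
  unfolding P_def by (rule in_ran_kern[OF onf_b])

text \<open>Brings a kernel identity into the averaging form required by the maximum
  principle.\<close>

lemma kernel_bound:
  fixes s :: complex
  assumes "((\<lambda>x::'d lat. k x * \<phi> x) has_sum s) UNIV" "\<And>x. cmod (k x) \<le> \<epsilon> * exp (- (2 * \<kappa> * linf_dist x y))"
    "\<And>x. cmod (\<phi> x) \<le> 1" "c / 32 \<le> \<kappa>"
  shows "cmod s \<le> (\<Sum>\<^sub>\<infinity>x. \<epsilon> * exp (- (2 * \<kappa> * linf_dist x y)) * cmod (\<phi> x))"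
proof -
  have e0: "0 \<le> \<epsilon> * exp (- (2 * \<kappa> * linf_dist x y))" for x
    using assms(2)[of x] norm_ge_zero[of "k x"] by linarith
  have "(\<lambda>x. \<epsilon> * exp (- (2 * \<kappa> * linf_dist x y)) * cmod (\<phi> x)) summable_on UNIV"
  proof (rule summable_on_comparison_test)
    show "(\<lambda>x. \<epsilon> * exp (- (2 * \<kappa> * linf_dist x y))) summable_on UNIV"
      using c_pos assms(4) by (intro summable_on_cmult_right exp_summable) simp
    show "\<epsilon> * exp (- (2 * \<kappa> * linf_dist x y)) * cmod (\<phi> x) \<le> \<epsilon> * exp (- (2 * \<kappa> * linf_dist x y))" for x
      using mult_left_mono[OF assms(3)[of x] e0[of x]] by simp
  qed (use e0 in auto)
  then show ?thesis
    by (intro norm_infsum_le[OF assms(1) has_sum_infsum])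
      (auto simp: norm_mult intro!: mult_right_mono assms(2))
qed

text \<open>The geometric mean of the Cauchy-Schwarz bound and the exponential bound: half of the
  rate is given up in exchange for a small prefactor.\<close>

lemma P_small_outside:
  assumes "y \<notin> A0"
  shows "cmod (P y x) \<le> exp (- \<Lambda> / 2) * exp (- (2 * (c / 4) * linf_dist x y))"
proof (rule power2_le_imp_le)
  have "(cmod (P y x))\<^sup>2 \<le> D y * D x" by (rule P_cauchy_schwarz)
  also have "\<dots> \<le> exp (- 4 * \<Lambda>) * 1"
    using assms D_nonneg D_le_one by (intro mult_mono) (auto simp: A0_def)
  also have "\<dots> = (exp (- 2 * \<Lambda>))\<^sup>2" by (simp add: power2_eq_square exp_add[symmetric])
  finally have 1: "cmod (P y x) \<le> exp (- 2 * \<Lambda>)" by (rule power2_le_imp_le) simp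
  have "(cmod (P y x))\<^sup>2 \<le> exp (- 2 * \<Lambda>) * exp (\<Lambda> - c * linf_dist y x)"
    unfolding power2_eq_square using 1 P_decay[of y x] by (intro mult_mono) auto
  also have "\<dots> = (exp (- \<Lambda> / 2) * exp (- (2 * (c / 4) * linf_dist x y)))\<^sup>2"
    by (simp add: power2_eq_square exp_add[symmetric] linf_commute field_simps)
  finally show "(cmod (P y x))\<^sup>2 \<le> (exp (- \<Lambda> / 2) * exp (- (2 * (c / 4) * linf_dist x y)))\<^sup>2" .
qed simp

text \<open>\<open>D x\<close> is the squared norm of the column at \<open>x\<close>. Terms inside
  the ball are at most \<open>D x * D y\<close>, and those outside sum to at most
  \<open>D x / 2\<close> because \<open>D x\<close> is not below
  \<open>exp (- 4 * \<Lambda>)\<close>. Dividing by \<open>D x\<close> leaves the local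
  trace.\<close>

lemma trace_ball:
  assumes "x \<in> A0"
  shows "1 / 2 \<le> (\<Sum>y\<in>lball x R1. D y)"
proof -
  define T where "T = (\<Sum>y\<in>lball x R1. D y)"
  have "((\<lambda>y. if y \<in> lball x R1 then D x * D y else 0) has_sum D x * T) UNIV"
    by (rule has_sum_finite_neutralI[of "lball x R1"]) (auto simp: T_def sum_distrib_left finite_lball)
  moreover have "((\<lambda>y. exp (- 6 * \<Lambda>) * exp (- (c * linf_dist y x))) has_sum
      exp (- 6 * \<Lambda>) * (\<Sum>\<^sub>\<infinity>y. exp (- (c * linf_dist y x)))) UNIV"
    using c_pos by (intro has_sum_cmult_right has_sum_infsum exp_summable) simp
  ultimately have hs: "((\<lambda>y. (if y \<in> lball x R1 then D x * D y else 0) + exp (- 6 * \<Lambda>) * exp (- (c * linf_dist y x))) has_sum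
      D x * T + exp (- 6 * \<Lambda>) * (\<Sum>\<^sub>\<infinity>y. exp (- (c * linf_dist y x)))) UNIV" by (rule has_sum_add)
  have "D x \<le> D x * T + exp (- 6 * \<Lambda>) * (\<Sum>\<^sub>\<infinity>y. exp (- (c * linf_dist y x)))"
  proof (rule has_sum_mono[OF has_sum_column[of x] hs])
    fix y
    show "(cmod (P y x))\<^sup>2 \<le> (if y \<in> lball x R1 then D x * D y else 0) + exp (- 6 * \<Lambda>) * exp (- (c * linf_dist y x))"
    proof (cases "y \<in> lball x R1")
      case True
      then show ?thesis using P_cauchy_schwarz[of y x] by (simp add: mult.commute add_increasing2)
    next
      case False
      then have "8 * \<Lambda> < c * linf_dist y x" using c_pos by (simp add: lball_def field_simps)
      then have "2 * \<Lambda> - 2 * (c * linf_dist y x) \<le> - 6 * \<Lambda> - c * linf_dist y x" by simp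
      moreover have "(cmod (P y x))\<^sup>2 \<le> (exp (\<Lambda> - c * linf_dist y x))\<^sup>2"
        using P_decay[of y x] by (rule power_mono) simp
      moreover have "(exp (\<Lambda> - c * linf_dist y x))\<^sup>2 = exp (2 * \<Lambda> - 2 * (c * linf_dist y x))"
        by (simp add: power2_eq_square exp_add[symmetric])
      ultimately have "(cmod (P y x))\<^sup>2 \<le> exp (- 6 * \<Lambda> - c * linf_dist y x)" by (smt (verit) exp_le_cancel_iff)
      then show ?thesis using False by (simp add: exp_add[symmetric])
    qed
  qed
  also have "exp (- 6 * \<Lambda>) * (\<Sum>\<^sub>\<infinity>y. exp (- (c * linf_dist y x))) \<le> exp (- 6 * \<Lambda>) * (exp (\<Lambda> / 2) / 2)"
    using exp_summable(2)[of c x] c_pos S_le by (intro mult_left_mono) auto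
  also have "exp (- 6 * \<Lambda>) * (exp (\<Lambda> / 2) / 2) = exp (- 6 * \<Lambda> + \<Lambda> / 2) / 2" by (simp add: exp_add[symmetric])
  also have "\<dots> \<le> exp (- 4 * \<Lambda>) / 2" using \<Lambda>_ge by simp
  also have "\<dots> \<le> D x / 2" using assms by (simp add: A0_def)
  finally have "D x * (1 / 2) \<le> D x * T" by simp
  moreover have "D x > 0" using assms by (simp add: A0_def less_le_trans[OF exp_gt_zero])
  ultimately show ?thesis unfolding T_def by (simp only: mult_le_cancel_left_pos)
qed

lemma sum_D_le: "finite T \<Longrightarrow> (\<Sum>x\<in>T. D x) \<le> m"
  using sum_kern_diag_le[OF onf_b] by (simp add: D_def P_def)

definition separated :: "'d lat set \<Rightarrow> bool" where
  "separated Z \<longleftrightarrow> finite Z \<and> Z \<subseteq> A0 \<and> (\<forall>z\<in>Z. \<forall>z'\<in>Z. z \<noteq> z' \<longrightarrow> 2 * R1 < linf_dist z z')"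

lemma balls_disjoint:
  assumes "2 * r < linf_dist z z'"
  shows "lball z r \<inter> lball z' r = {}"
proof -
  have False if "linf_dist x z \<le> r" "linf_dist x z' \<le> r" for x
    using linf_triangle[of z z' x] that assms by (simp add: linf_commute)
  then show ?thesis by (auto simp: lball_def)
qed

text \<open>The balls of radius \<open>R1\<close> are disjoint and each holds trace at least 1/2,
  out of a total of at most \<open>m\<close>.\<close>

lemma separated_card:
  assumes "separated Z"
  shows "card Z \<le> 2 * m"
proof -
  have fin: "finite Z" and sub: "Z \<subseteq> A0" using assms by (auto simp: separated_def)
  have "card Z * (1 / 2) = (\<Sum>z\<in>Z. 1 / 2 :: real)" by simp
  also have "\<dots> \<le> (\<Sum>z\<in>Z. \<Sum>y\<in>lball z R1. D y)"
    using sub by (intro sum_mono trace_ball) auto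
  also have "\<dots> = (\<Sum>y\<in>(\<Union>z\<in>Z. lball z R1). D y)"
    using assms by (intro sum.UNION_disjoint[symmetric] fin)
      (auto simp: finite_lball separated_def intro!: balls_disjoint)
  also have "\<dots> \<le> m" by (intro sum_D_le finite_UN_I fin finite_lball)
  finally show ?thesis by simp
qed

lemma unit_in_ran_le_one: "in_ran I b \<phi> \<Longrightarrow> l2_inner \<phi> \<phi> = 1 \<Longrightarrow> cmod (\<phi> x) \<le> 1"
  by (rule unit_le_one[OF in_ran_l2])

lemma eps_S1: "exp (- \<Lambda> / 2) * S \<le> 1 / 2"
proof -
  have "exp (- \<Lambda> / 2) * (2 * S) \<le> exp (- \<Lambda> / 2) * exp (\<Lambda> / 2)"
    using S_le by (intro mult_left_mono) auto
  also have "\<dots> = 1" by (simp add: exp_add[symmetric])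
  finally show ?thesis by simp
qed

lemma outside_A0:
  assumes "in_ran I b \<phi>" "l2_inner \<phi> \<phi> = 1" "y \<notin> A0"
  shows "cmod (\<phi> y) \<le> (\<Sum>\<^sub>\<infinity>x. exp (- \<Lambda> / 2) * exp (- (2 * (c / 4) * linf_dist x y)) * cmod (\<phi> x))"
  by (rule kernel_bound[OF has_sum_P[OF assms(1)] P_small_outside[OF assms(3)] unit_in_ran_le_one[OF assms(1,2)]])
    (use c_pos in simp)

lemma A0_nonempty: "A0 \<noteq> {}"
proof
  assume A0: "A0 = {}"
  have i: "0 \<in> I" using m_pos by simp
  note r = in_ran_member[OF onf_b i] and u = onfD(3)[OF onf_b i]
  \<comment> \<open>The maximum principle with \<open>B = 0\<close> and distance function 0: with no
    exceptional set, nothing feeds the mode, and the unit vector \<open>b 0\<close> would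
    vanish.\<close>
  have "cmod (b 0 y) \<le> 0 * exp (- (c / 4 * 0))" for y
  proof (rule decay_off_set[where A = A0 and \<epsilon> = "exp (- \<Lambda> / 2)" and S = S and G = 1])
    show "cmod (b 0 y) \<le> (\<Sum>\<^sub>\<infinity>x. exp (- \<Lambda> / 2) * exp (- (2 * (c / 4) * linf_dist x y)) * cmod (b 0 x))"
      if "y \<notin> A0" for y using that by (rule outside_A0[OF r u])
    show "(\<lambda>x. exp (- (c / 4 * linf_dist x z))) summable_on UNIV" for z :: "'d lat"
      by (rule exp_summable) (use c_pos in simp)
    show "(\<Sum>\<^sub>\<infinity>x. exp (- (c / 4 * linf_dist x z))) \<le> S" for z :: "'d lat"
      by (rule exp_summable) (use c_pos in simp)
  qed (use A0 c_pos eps_S1 unit_in_ran_le_one[OF r u] linf_nonneg in auto)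
  then have "b 0 = (\<lambda>x. 0)" by auto
  then show False using u by simp
qed

text \<open>A separated set of greatest size, which exists by the bound \<open>2 * m\<close>. A
  point of \<open>A0\<close> far from all its members could be added to it.\<close>

lemma centers_exist:
  obtains Z where "separated Z" "Z \<noteq> {}" "\<And>x. x \<in> A0 \<Longrightarrow> \<exists>z\<in>Z. linf_dist x z \<le> 2 * R1"
proof -
  have "separated {}" by (simp add: separated_def)
  then obtain Z where Z: "separated Z" and max: "\<And>Y. separated Y \<Longrightarrow> card Y \<le> card Z"
    using ex_has_greatest_nat[of separated "{}" card "Suc (2 * m)"] separated_card by (meson le_imp_less_Suc)
  have cover: "\<exists>z\<in>Z. linf_dist x z \<le> 2 * R1" if x: "x \<in> A0" for x
  proof (rule ccontr)
    assume no: "\<not> ?thesis"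
    then have far: "\<And>z. z \<in> Z \<Longrightarrow> 2 * R1 < linf_dist x z" by (auto simp: not_le)
    have "x \<notin> Z"
    proof
      assume "x \<in> Z"
      then have "2 * R1 < linf_dist x x" by (rule far)
      then show False using c_pos \<Lambda>_ge by (simp add: divide_less_0_iff)
    qed
    moreover have "separated (insert x Z)"
      using Z x far by (auto simp: separated_def linf_commute)
    ultimately show False using max[of "insert x Z"] Z by (simp add: separated_def)
  qed
  moreover have "Z \<noteq> {}" using A0_nonempty cover by blast
  ultimately show ?thesis using Z that by blast
qed

end

lemma exp_le_quarter: "t \<le> - 2 \<Longrightarrow> exp (t :: real) \<le> 1 / 4"
proof -
  assume "t \<le> - 2"
  then have "exp t \<le> exp (- 2)" by simp
  also have "exp (- 2 :: real) = inverse (exp 1 * exp 1)" by (simp add: exp_add[symmetric] exp_minus)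
  also have "\<dots> \<le> inverse (2 * 2)"
    using exp_ge_add_one_self[of 1] by (intro le_imp_inverse_le mult_mono) auto
  finally show ?thesis by simp
qed

section \<open>Separating the modes of different clusters\<close>

locale clustered_projection = localized_projection +
  fixes Z :: "'a lat set" and lab :: "'a lat \<Rightarrow> nat"
  assumes Z: "separated Z" "Z \<noteq> {}" "\<And>x. x \<in> A0 \<Longrightarrow> \<exists>z\<in>Z. linf_dist x z \<le> 2 * R1"
    and lab_less: "\<And>z. z \<in> Z \<Longrightarrow> lab z < card Z"
    and lab_near: "\<And>z z'. z \<in> Z \<Longrightarrow> z' \<in> Z \<Longrightarrow> lab z = lab z' \<Longrightarrow> linf_dist z z' \<le> 2 * card Z * (192 * \<Lambda> / c)"
    and lab_far: "\<And>z z'. z \<in> Z \<Longrightarrow> z' \<in> Z \<Longrightarrow> lab z \<noteq> lab z' \<Longrightarrow> 192 * \<Lambda> / c < linf_dist z z'"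
begin

lemma finite_Z: "finite Z" using Z(1) by (simp add: separated_def)

lemma card_Z: "card Z \<le> 2 * m" by (rule separated_card[OF Z(1)])

lemma mode_decay:
  assumes "in_ran I b \<phi>" "l2_inner \<phi> \<phi> = 1"
  shows "cmod (\<phi> y) \<le> exp (4 * \<Lambda>) * exp (- (c / 4 * dset Z y))"
proof (rule decay_off_set[where A = A0 and \<epsilon> = "exp (- \<Lambda> / 2)" and S = S and G = 1])
  show "cmod (\<phi> y) \<le> (\<Sum>\<^sub>\<infinity>x. exp (- \<Lambda> / 2) * exp (- (2 * (c / 4) * linf_dist x y)) * cmod (\<phi> x))"
    if "y \<notin> A0" for y using that by (rule outside_A0[OF assms])
  show "(\<lambda>x. exp (- (c / 4 * linf_dist x z))) summable_on UNIV" for z :: "'a lat"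
    by (rule exp_summable) (use c_pos in simp)
  show "(\<Sum>\<^sub>\<infinity>x. exp (- (c / 4 * linf_dist x z))) \<le> S" for z :: "'a lat"
    by (rule exp_summable) (use c_pos in simp)
  \<comment> \<open>The set \<open>A0\<close> lies within \<open>2 * R1 = 16 * \<Lambda> / c\<close>
    of the centers; at rate \<open>c / 4\<close> this costs the prefactor
    \<open>exp (4 * \<Lambda>)\<close>.\<close>
  show "cmod (\<phi> y) \<le> exp (4 * \<Lambda>) * exp (- (c / 4 * dset Z y))" if y: "y \<in> A0" for y
  proof -
    obtain z where "z \<in> Z" "linf_dist y z \<le> 2 * R1" using Z(3)[OF y] by blast
    then have "dset Z y \<le> 16 * \<Lambda> / c" using dset_le[OF finite_Z, of z y] by simp
    then have "c / 4 * dset Z y \<le> 4 * \<Lambda>" using c_pos by (simp add: field_simps)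
    then have "1 \<le> exp (4 * \<Lambda>) * exp (- (c / 4 * dset Z y))" by (simp add: exp_add[symmetric])
    then show ?thesis using unit_in_ran_le_one[OF assms, of y] by linarith
  qed
qed (use c_pos eps_S1 unit_in_ran_le_one[OF assms] dset_nonneg[OF finite_Z Z(2)] dset_Lipschitz[OF finite_Z Z(2)] in auto)

lemma D_decay: "D y \<le> exp (9 * \<Lambda>) * exp (- (c / 2 * dset Z y))"
proof -
  have "D y \<le> (\<Sum>i\<in>I. (exp (4 * \<Lambda>) * exp (- (c / 4 * dset Z y)))\<^sup>2)"
    unfolding D_eq using in_ran_member[OF onf_b] onfD(3)[OF onf_b]
    by (intro sum_mono power_mono mode_decay) auto
  also have "\<dots> = real m * (exp (8 * \<Lambda>) * exp (- (c / 2 * dset Z y)))"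
    by (simp add: power2_eq_square exp_add[symmetric])
  also have "\<dots> \<le> exp \<Lambda> * (exp (8 * \<Lambda>) * exp (- (c / 2 * dset Z y)))"
    by (intro mult_right_mono m_le) auto
  also have "\<dots> = exp (9 * \<Lambda>) * exp (- (c / 2 * dset Z y))"
    by (simp add: exp_add[symmetric])
  finally show ?thesis .
qed

definition near :: "'a lat \<Rightarrow> 'a lat" where
  "near y = (SOME z. z \<in> Z \<and> dset Z y = linf_dist y z)"

lemma near: "near y \<in> Z" "dset Z y = linf_dist y (near y)"
proof -
  have "near y \<in> Z \<and> dset Z y = linf_dist y (near y)"
    unfolding near_def by (rule someI_ex) (metis dset_attained[OF finite_Z Z(2)])
  then show "near y \<in> Z" "dset Z y = linf_dist y (near y)" by blast+
qed

definition label :: "'a lat \<Rightarrow> nat" where "label y = lab (near y)"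

definition Zc :: "nat \<Rightarrow> 'a lat set" where "Zc n = {z \<in> Z. lab z = n}"

lemma finite_Zc: "finite (Zc n)" using finite_Z by (simp add: Zc_def)

lemma Zc_nonempty: "n \<in> lab ` Z \<Longrightarrow> Zc n \<noteq> {}" by (auto simp: Zc_def)

lemma label_in: "label y \<in> lab ` Z" using near(1) by (auto simp: label_def)

lemma dset_label: "dset (Zc (label y)) y \<le> dset Z y"
  unfolding near(2)[of y] by (rule dset_le[OF finite_Zc]) (use near(1) in \<open>simp add: Zc_def label_def\<close>)

text \<open>Centers with different labels are far apart, so either the two points are far from each
  other or one of them is far from all centers.\<close>

lemma label_jump:
  assumes "label x \<noteq> label y"
  shows "192 * \<Lambda> < c * (linf_dist x y + dset Z x + dset Z y)"
proof -
  have "192 * \<Lambda> / c < linf_dist (near x) (near y)"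
    using assms near by (intro lab_far) (auto simp: label_def)
  also have "\<dots> \<le> linf_dist (near x) x + linf_dist x (near y)" by (rule linf_triangle)
  also have "\<dots> \<le> linf_dist x y + dset Z x + dset Z y"
    using linf_triangle[of x "near y" y] by (simp add: near(2) linf_commute)
  finally show ?thesis using c_pos by (simp add: field_simps)
qed

text \<open>Distance between the points is paid for by the kernel decay, distance from the centers
  by the decay of the diagonal through Cauchy-Schwarz. In the product of the two bounds it is enough
  that the sum \<open>r + s\<close> is large.\<close>

lemma P_jump:
  assumes "label x \<noteq> label y"
  shows "cmod (P y x) \<le> exp (- 7 * \<Lambda>) * exp (- (2 * (c / 32) * linf_dist x y))"
proof (rule power2_le_imp_le)
  define r where "r = c * linf_dist x y"
  define s where "s = c * (dset Z x + dset Z y)"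
  have r0: "0 \<le> r" using c_pos linf_nonneg[of x y] by (simp add: r_def)
  have rs: "192 * \<Lambda> < r + s" using label_jump[OF assms] by (simp add: r_def s_def algebra_simps)
  have "(cmod (P y x))\<^sup>2 \<le> D y * D x" by (rule P_cauchy_schwarz)
  also have "\<dots> \<le> (exp (9 * \<Lambda>) * exp (- (c / 2 * dset Z y))) * (exp (9 * \<Lambda>) * exp (- (c / 2 * dset Z x)))"
    by (intro mult_mono D_decay D_nonneg) auto
  also have "\<dots> = (exp (9 * \<Lambda> - s / 4))\<^sup>2"
    by (simp add: power2_eq_square exp_add[symmetric] s_def algebra_simps)
  finally have 1: "cmod (P y x) \<le> exp (9 * \<Lambda> - s / 4)" by (rule power2_le_imp_le) simp
  have "(cmod (P y x))\<^sup>2 \<le> exp (9 * \<Lambda> - s / 4) * exp (\<Lambda> - r)"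
    unfolding power2_eq_square using 1 P_decay[of y x] by (intro mult_mono) (auto simp: r_def linf_commute)
  also have "\<dots> = exp (10 * \<Lambda> - s / 4 - r)" by (simp add: exp_add[symmetric])
  also have "\<dots> \<le> exp (2 * (- 7 * \<Lambda> - r / 16))"
    using rs r0 \<Lambda>_ge by simp
  also have "\<dots> = (exp (- 7 * \<Lambda>) * exp (- (2 * (c / 32) * linf_dist x y)))\<^sup>2"
    by (simp add: power2_eq_square exp_add[symmetric] r_def)
  finally show "(cmod (P y x))\<^sup>2 \<le> (exp (- 7 * \<Lambda>) * exp (- (2 * (c / 32) * linf_dist x y)))\<^sup>2" .
qed simp

lemma eps_S2: "4 * exp (- 6 * \<Lambda>) * S \<le> 1 / 2"
proof -
  have "4 * exp (- 6 * \<Lambda>) * S = 2 * exp (- 6 * \<Lambda>) * (2 * S)" by simp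
  also have "\<dots> \<le> 2 * exp (- 6 * \<Lambda>) * exp (\<Lambda> / 2)"
    using S_le by (intro mult_left_mono) auto
  also have "\<dots> = 2 * exp (- 6 * \<Lambda> + \<Lambda> / 2)" by (simp only: exp_add mult.assoc)
  also have "\<dots> \<le> 1 / 2" using exp_le_quarter[of "- 6 * \<Lambda> + \<Lambda> / 2"] \<Lambda>_ge by simp
  finally show ?thesis .
qed

text \<open>The commutator kernel lives on pairs with different labels, where \<open>P_jump\<close>
  applies. Labels differ by at most \<open>2 * m \<le> 2 * exp \<Lambda>\<close>, which costs one of
  the seven factors \<open>exp (- \<Lambda>)\<close>. Where the label is \<open>n\<close>, a nearest
  center belongs to the cluster, and the decay away from \<open>Z\<close> suffices.\<close>

lemma eigenmode_decay:
  assumes r: "in_ran I b \<phi>" and u: "l2_inner \<phi> \<phi> = 1"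
    and eig: "\<And>y. ((\<lambda>x. P y x * (of_nat (label x) * \<phi> x)) has_sum (\<mu> * \<phi> y)) UNIV"
  shows "\<exists>n\<in>lab ` Z. \<forall>y. cmod (\<phi> y) \<le> exp (4 * \<Lambda>) * exp (- (c / 32 * dset (Zc n) y))"
proof -
  have fin: "finite (lab ` Z)" "lab ` Z \<noteq> {}" using finite_Z Z(2) by auto
  obtain n where n: "n \<in> lab ` Z" and nmin: "\<And>k. k \<in> lab ` Z \<Longrightarrow> cmod (of_nat n - \<mu>) \<le> cmod (of_nat k - \<mu>)"
    using arg_min_if_finite[OF fin, of "\<lambda>k. cmod (of_nat k - \<mu>)"] by (meson not_le)
  \<comment> \<open>The distances of \<open>k\<close> and \<open>n\<close> to \<open>\<mu>\<close>
    add up to at least 1, and that of \<open>k\<close> is the larger one.\<close>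
  have half: "1 \<le> cmod (2 * (of_nat k - \<mu>))" if k: "k \<in> lab ` Z" "k \<noteq> n" for k
  proof -
    have "1 \<le> \<bar>real k - real n\<bar>" using k(2) by linarith
    also have "\<dots> = cmod (of_nat k - of_nat n)"
      by (metis norm_of_real of_real_diff of_real_of_nat_eq)
    also have "\<dots> \<le> cmod (of_nat k - \<mu>) + cmod (of_nat n - \<mu>)"
      using norm_triangle_ineq4[of "of_nat k - \<mu>" "of_nat n - \<mu>"] by simp
    finally show ?thesis using nmin[OF k(1)] unfolding norm_mult by simp
  qed
  have "cmod (\<phi> y) \<le> exp (4 * \<Lambda>) * exp (- (c / 32 * dset (Zc n) y))" for y
  proof (rule decay_off_set[where A = "{y. label y = n}" and \<epsilon> = "4 * exp (- 6 * \<Lambda>)" and S = S and G = 1])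
    show "(\<lambda>x. exp (- (c / 32 * linf_dist x z))) summable_on UNIV" for z :: "'a lat"
      by (rule exp_summable) simp
    show "(\<Sum>\<^sub>\<infinity>x. exp (- (c / 32 * linf_dist x z))) \<le> S" for z :: "'a lat"
      by (rule exp_summable) simp
    show "cmod (\<phi> y) \<le> exp (4 * \<Lambda>) * exp (- (c / 32 * dset (Zc n) y))" if "y \<in> {y. label y = n}" for y
    proof -
      have "dset (Zc n) y \<le> dset Z y" using dset_label[of y] that by simp
      moreover have "dset Z y \<ge> 0" by (rule dset_nonneg[OF finite_Z Z(2)])
      ultimately have "c / 32 * dset (Zc n) y \<le> c / 4 * dset Z y"
        using c_pos by (intro mult_mono') (auto intro: dset_nonneg[OF finite_Zc Zc_nonempty[OF n]])
      then have "exp (4 * \<Lambda>) * exp (- (c / 4 * dset Z y)) \<le> exp (4 * \<Lambda>) * exp (- (c / 32 * dset (Zc n) y))"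
        by (intro mult_left_mono) auto
      then show ?thesis using mode_decay[OF r u, of y] by linarith
    qed
    show "cmod (\<phi> y) \<le> (\<Sum>\<^sub>\<infinity>x. 4 * exp (- 6 * \<Lambda>) * exp (- (2 * (c / 32) * linf_dist x y)) * cmod (\<phi> x))"
      if y: "y \<notin> {y. label y = n}" for y
    proof -
      \<comment> \<open>The commutator kernel, doubled so that the factor
        \<open>2 * (of_nat (label y) - \<mu>)\<close> on the left has modulus at least 1.\<close>
      define k where "k x = 2 * (P y x * (of_nat (label y) - of_nat (label x)))" for x
      have "((\<lambda>x. of_nat (label y) * (P y x * \<phi> x) - P y x * (of_nat (label x) * \<phi> x)) has_sum
          of_nat (label y) * \<phi> y - \<mu> * \<phi> y) UNIV"
        using has_sum_add[OF has_sum_cmult_right[OF has_sum_P[OF r], of "of_nat (label y)" y]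
          has_sum_cmult_right[OF eig[of y], of "- 1"]] by simp
      then have "((\<lambda>x. 2 * (of_nat (label y) * (P y x * \<phi> x) - P y x * (of_nat (label x) * \<phi> x))) has_sum
          2 * (of_nat (label y) * \<phi> y - \<mu> * \<phi> y)) UNIV" by (rule has_sum_cmult_right)
      then have hs: "((\<lambda>x. k x * \<phi> x) has_sum 2 * (of_nat (label y) - \<mu>) * \<phi> y) UNIV"
        by (simp add: k_def algebra_simps)
      have kb: "cmod (k x) \<le> 4 * exp (- 6 * \<Lambda>) * exp (- (2 * (c / 32) * linf_dist x y))" for x
      proof (cases "label x = label y")
        case True
        then show ?thesis by (simp add: k_def)
      next
        case False
        have lt: "label q \<le> 2 * m" for q
          using lab_less[OF near(1)[of q]] card_Z by (simp add: label_def)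
        have "cmod (of_nat (label y) - of_nat (label x)) = \<bar>real (label y) - real (label x)\<bar>"
          by (metis norm_of_real of_real_diff of_real_of_nat_eq)
        also have "\<dots> \<le> 2 * real m" using lt[of x] lt[of y] by linarith
        also have "\<dots> \<le> 2 * exp \<Lambda>" using m_le by simp
        finally have "cmod (k x) \<le> 2 * ((exp (- 7 * \<Lambda>) * exp (- (2 * (c / 32) * linf_dist x y))) * (2 * exp \<Lambda>))"
          unfolding k_def norm_mult using P_jump[OF False] by (intro mult_mono) auto
        also have "\<dots> = 4 * (exp (- 7 * \<Lambda>) * exp \<Lambda>) * exp (- (2 * (c / 32) * linf_dist x y))"
          by simp
        also have "exp (- 7 * \<Lambda>) * exp \<Lambda> = exp (- 6 * \<Lambda>)" by (simp add: exp_add[symmetric])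
        finally show ?thesis .
      qed
      have "1 * cmod (\<phi> y) \<le> cmod (2 * (of_nat (label y) - \<mu>)) * cmod (\<phi> y)"
        using y by (intro mult_right_mono half label_in) auto
      also have "\<dots> = cmod (2 * (of_nat (label y) - \<mu>) * \<phi> y)" by (simp only: norm_mult)
      also have "\<dots> \<le> (\<Sum>\<^sub>\<infinity>x. 4 * exp (- 6 * \<Lambda>) * exp (- (2 * (c / 32) * linf_dist x y)) * cmod (\<phi> x))"
        by (rule kernel_bound[OF hs kb unit_in_ran_le_one[OF r u]]) simp
      finally show ?thesis by simp
    qed
  qed (use c_pos eps_S2 unit_in_ran_le_one[OF r u] dset_nonneg[OF finite_Zc Zc_nonempty[OF n]]
      dset_Lipschitz[OF finite_Zc Zc_nonempty[OF n]] in auto)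
  then show ?thesis using n by blast
qed

lemma eigenmodes_exist:
  obtains \<psi> \<nu> where "onf I \<psi>" "kern I \<psi> = P" "\<And>i. i < m \<Longrightarrow> \<nu> i \<in> lab ` Z"
    "\<And>i y. i < m \<Longrightarrow> cmod (\<psi> i y) \<le> exp (4 * \<Lambda>) * exp (- (c / 32 * dset (Zc (\<nu> i)) y))"
proof -
  have bd: "\<bar>real (label x)\<bar> \<le> real (2 * m)" for x
    using lab_less[OF near(1)[of x]] card_Z by (simp add: label_def)
  obtain \<psi> where \<psi>: "onf I \<psi>" "kern I \<psi> = kern I b"
    and off: "\<And>i j. i < m \<Longrightarrow> j < m \<Longrightarrow> i \<noteq> j \<Longrightarrow> l2_inner (\<psi> i) (\<lambda>x. of_real (real (label x)) * \<psi> j x) = 0"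
    using onf_diagonalize[OF onf_b, of "\<lambda>x. real (label x)", OF bd] by metis
  have "\<exists>n\<in>lab ` Z. \<forall>y. cmod (\<psi> j y) \<le> exp (4 * \<Lambda>) * exp (- (c / 32 * dset (Zc n) y))" if j: "j < m" for j
  \<comment> \<open>With vanishing off-diagonal entries, the diagonal entry of the compressed label
    function is the eigenvalue.\<close>
  proof (rule eigenmode_decay[where \<mu> = "l2_inner (\<psi> j) (\<lambda>x. of_real (real (label x)) * \<psi> j x)"])
    have jI: "j \<in> I" using j by simp
    show "in_ran I b (\<psi> j)"
      by (rule in_ran_cong[OF \<psi>(1) onf_b \<psi>(2) in_ran_member[OF \<psi>(1) jI]])
    show "l2_inner (\<psi> j) (\<psi> j) = 1" by (rule onfD(3)[OF \<psi>(1) jI])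
    fix y
    have l2: "in_l2 (\<lambda>x. of_real (real (label x)) * \<psi> j x)"
      by (rule in_l2_mult_bounded[OF onfD(2)[OF \<psi>(1) jI] bd])
    have "((\<lambda>x. kern I \<psi> y x * (of_real (real (label x)) * \<psi> j x)) has_sum
        (\<Sum>i\<in>I. l2_inner (\<psi> i) (\<lambda>x. of_real (real (label x)) * \<psi> j x) * \<psi> i y)) UNIV"
      by (rule has_sum_kern[OF onfD(1,2)[OF \<psi>(1)] l2])
    also have "(\<Sum>i\<in>I. l2_inner (\<psi> i) (\<lambda>x. of_real (real (label x)) * \<psi> j x) * \<psi> i y)
        = (\<Sum>i\<in>I. if i = j then l2_inner (\<psi> j) (\<lambda>x. of_real (real (label x)) * \<psi> j x) * \<psi> j y else 0)"
      using off[OF _ j] by (intro sum.cong) auto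
    also have "\<dots> = l2_inner (\<psi> j) (\<lambda>x. of_real (real (label x)) * \<psi> j x) * \<psi> j y"
      using jI by simp
    finally show "((\<lambda>x. P y x * (of_nat (label x) * \<psi> j x)) has_sum
        l2_inner (\<psi> j) (\<lambda>x. of_real (real (label x)) * \<psi> j x) * \<psi> j y) UNIV"
      by (simp add: P_def \<psi>(2))
  qed
  then obtain \<nu> where "\<And>j. j < m \<Longrightarrow> \<nu> j \<in> lab ` Z \<and> (\<forall>y. cmod (\<psi> j y) \<le> exp (4 * \<Lambda>) * exp (- (c / 32 * dset (Zc (\<nu> j)) y)))"
    by metis
  then show ?thesis using \<psi> by (intro that[of \<psi> \<nu>]) (auto simp: P_def)
qed

end

section \<open>Peaked bases within a single cluster\<close>

locale clustered_modes = clustered_projection +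
  fixes \<psi> :: "nat \<Rightarrow> 'a wave" and \<nu> :: "nat \<Rightarrow> nat"
  assumes onf_\<psi>: "onf I \<psi>" and kern_\<psi>: "kern I \<psi> = P"
    and \<nu>_in: "\<And>i. i < m \<Longrightarrow> \<nu> i \<in> lab ` Z"
    and \<psi>_decay: "\<And>i y. i < m \<Longrightarrow> cmod (\<psi> i y) \<le> exp (4 * \<Lambda>) * exp (- (c / 32 * dset (Zc (\<nu> i)) y))"
begin

definition In :: "nat \<Rightarrow> nat set" where "In n = {i \<in> I. \<nu> i = n}"

lemma finite_In: "finite (In n)" by (simp add: In_def)

lemma onf_In: "onf (In n) \<psi>" by (rule onf_subset[OF onf_\<psi>]) (auto simp: In_def)

lemma \<psi>_sq_decay:
  assumes "i < m"
  shows "(cmod (\<psi> i y))\<^sup>2 \<le> exp (8 * \<Lambda>) * exp (- (c / 16 * dset (Zc (\<nu> i)) y))"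
proof -
  have "(cmod (\<psi> i y))\<^sup>2 \<le> (exp (4 * \<Lambda>) * exp (- (c / 32 * dset (Zc (\<nu> i)) y)))\<^sup>2"
    by (intro power_mono \<psi>_decay assms) simp
  also have "\<dots> = exp (8 * \<Lambda>) * exp (- (c / 16 * dset (Zc (\<nu> i)) y))"
    by (simp add: power2_eq_square exp_add[symmetric])
  finally show ?thesis .
qed

text \<open>Of the separation \<open>192 * \<Lambda> / c\<close>, the ball takes \<open>R1\<close>.
  The remaining \<open>184 * \<Lambda> / c\<close> at rate \<open>c / 16\<close> outweighs the
  prefactor \<open>exp (8 * \<Lambda>)\<close> with room for
  \<open>exp (- 3 * \<Lambda>)\<close>.\<close>

lemma foreign_mode_small:
  assumes z: "z \<in> Z" and x: "x \<in> lball z R1" and i: "i < m" "\<nu> i \<noteq> lab z"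
  shows "(cmod (\<psi> i x))\<^sup>2 \<le> exp (- 3 * \<Lambda>)"
proof -
  obtain z' where z': "z' \<in> Zc (\<nu> i)" "dset (Zc (\<nu> i)) x = linf_dist x z'"
    by (rule dset_attained[OF finite_Zc Zc_nonempty[OF \<nu>_in[OF i(1)]]])
  have "192 * \<Lambda> / c < linf_dist z z'"
    using z' i(2) z by (intro lab_far) (auto simp: Zc_def)
  also have "\<dots> \<le> linf_dist x z + linf_dist x z'"
    using linf_triangle[of z z' x] by (simp add: linf_commute)
  also have "linf_dist x z \<le> R1" using x by (simp add: lball_def)
  finally have "184 * \<Lambda> / c < linf_dist x z'" by (simp add: diff_divide_distrib[symmetric])
  then have "184 * \<Lambda> < c * linf_dist x z'" using c_pos by (simp add: field_simps)
  then have "8 * \<Lambda> - c / 16 * linf_dist x z' \<le> - 3 * \<Lambda>" using \<Lambda>_ge by simp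
  then have "exp (8 * \<Lambda>) * exp (- (c / 16 * linf_dist x z')) \<le> exp (- 3 * \<Lambda>)"
    by (simp add: exp_add[symmetric])
  then show ?thesis using \<psi>_sq_decay[OF i(1), of x] by (simp add: z'(2))
qed

text \<open>All modes together have local trace at least 1/2. The foreign share is at most
  \<open>exp \<Lambda>\<close> points times \<open>exp \<Lambda>\<close> modes times
  \<open>exp (- 3 * \<Lambda>)\<close>, hence at most 1/4.\<close>

lemma trace_ball_In:
  assumes z: "z \<in> Z"
  shows "1 / 4 \<le> (\<Sum>x\<in>lball z R1. Re (kern (In (lab z)) \<psi> x x))"
proof -
  define F where "F = {i \<in> I. \<nu> i \<noteq> lab z}"
  have split: "D x = Re (kern (In (lab z)) \<psi> x x) + (\<Sum>i\<in>F. (cmod (\<psi> i x))\<^sup>2)" for x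
  proof -
    have "D x = (\<Sum>i\<in>I. (cmod (\<psi> i x))\<^sup>2)"
      by (simp add: D_def kern_\<psi>[symmetric] kern_diag)
    also have "I = In (lab z) \<union> F" by (auto simp: In_def F_def)
    also have "(\<Sum>i\<in>In (lab z) \<union> F. (cmod (\<psi> i x))\<^sup>2)
        = (\<Sum>i\<in>In (lab z). (cmod (\<psi> i x))\<^sup>2) + (\<Sum>i\<in>F. (cmod (\<psi> i x))\<^sup>2)"
      by (intro sum.union_disjoint) (auto simp: In_def F_def)
    finally show ?thesis by (simp add: kern_diag)
  qed
  have fin: "finite F" by (simp add: F_def)
  have R1: "0 \<le> R1" using c_pos \<Lambda>_ge by simp
  have "(\<Sum>x\<in>lball z R1. \<Sum>i\<in>F. (cmod (\<psi> i x))\<^sup>2) \<le> (\<Sum>x\<in>lball z R1. \<Sum>i\<in>F. exp (- 3 * \<Lambda>))"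
    by (intro sum_mono foreign_mode_small[OF z]) (auto simp: F_def)
  also have "\<dots> = real (card (lball z R1)) * (real (card F) * exp (- 3 * \<Lambda>))" by simp
  also have "\<dots> \<le> exp \<Lambda> * (exp \<Lambda> * exp (- 3 * \<Lambda>))"
  proof (intro mult_mono)
    show "real (card (lball z R1)) \<le> exp \<Lambda>"
      using card_lball[OF R1, of z] \<Lambda>_ball1 by linarith
    have "card F \<le> card I" by (intro card_mono) (auto simp: F_def)
    then show "real (card F) \<le> exp \<Lambda>" using m_le by simp
  qed auto
  also have "\<dots> = exp (- \<Lambda>)" by (simp add: exp_add[symmetric])
  also have "\<dots> \<le> 1 / 4" using \<Lambda>_ge by (intro exp_le_quarter) simp
  finally have "(\<Sum>x\<in>lball z R1. \<Sum>i\<in>F. (cmod (\<psi> i x))\<^sup>2) \<le> 1 / 4" .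
  moreover have "1 / 2 \<le> (\<Sum>x\<in>lball z R1. D x)"
    using z Z(1) by (intro trace_ball) (auto simp: separated_def)
  ultimately show ?thesis by (simp add: split sum.distrib)
qed

text \<open>Disjoint balls with local trace 1/4 count the centers of a cluster against its own
  modes. This keeps \<open>m\<close> out of the lower bound for the peaks.\<close>

lemma card_cluster: "card (Zc n) \<le> 4 * card (In n)"
proof -
  have "card (Zc n) * (1 / 4) = (\<Sum>z\<in>Zc n. 1 / 4 :: real)" by simp
  also have "\<dots> \<le> (\<Sum>z\<in>Zc n. \<Sum>x\<in>lball z R1. Re (kern (In n) \<psi> x x))"
    using trace_ball_In by (intro sum_mono) (auto simp: Zc_def)
  also have "\<dots> = (\<Sum>x\<in>(\<Union>z\<in>Zc n. lball z R1). Re (kern (In n) \<psi> x x))"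
    using Z(1) by (intro sum.UNION_disjoint[symmetric] finite_Zc)
      (auto simp: finite_lball separated_def Zc_def intro!: balls_disjoint)
  also have "\<dots> \<le> card (In n)"
    by (intro sum_kern_diag_le onf_In finite_UN_I finite_Zc finite_lball)
  finally show ?thesis by simp
qed

text \<open>Bounding the tail by a sum over centers replaces the distance to the cluster by
  distances to points, for which \<open>S\<close> is available. The price is a factor
  \<open>card W \<le> 2 * exp \<Lambda>\<close>, covered by
  \<open>exp (- 2 * \<Lambda>)\<close>.\<close>

lemma mass_near_cluster:
  assumes i: "i < m"
  shows "3 / 4 \<le> (\<Sum>x\<in>(\<Union>z\<in>Zc (\<nu> i). lball z R2). (cmod (\<psi> i x))\<^sup>2)"
proof -
  define W where "W = Zc (\<nu> i)"
  define T where "T = (\<Union>z\<in>W. lball z R2)"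
  have W: "finite W" "W \<noteq> {}"
    unfolding W_def by (rule finite_Zc, rule Zc_nonempty[OF \<nu>_in[OF i]])
  have fT: "finite T" unfolding T_def by (intro finite_UN_I W finite_lball)
  have iI: "i \<in> I" using i by simp
  have "((\<lambda>x. if x \<in> T then (cmod (\<psi> i x))\<^sup>2 else 0) has_sum (\<Sum>x\<in>T. (cmod (\<psi> i x))\<^sup>2)) UNIV"
    by (rule has_sum_finite_neutralI[OF fT]) auto
  moreover have "((\<lambda>x. \<Sum>z\<in>W. exp (- 2 * \<Lambda>) * exp (- (c / 32 * linf_dist x z))) has_sum
      (\<Sum>z\<in>W. exp (- 2 * \<Lambda>) * (\<Sum>\<^sub>\<infinity>x. exp (- (c / 32 * linf_dist x z))))) UNIV"
    by (intro has_sum_sum has_sum_cmult_right has_sum_infsum S_summable)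
  ultimately have hs: "((\<lambda>x. (if x \<in> T then (cmod (\<psi> i x))\<^sup>2 else 0)
      + (\<Sum>z\<in>W. exp (- 2 * \<Lambda>) * exp (- (c / 32 * linf_dist x z)))) has_sum
      (\<Sum>x\<in>T. (cmod (\<psi> i x))\<^sup>2) + (\<Sum>z\<in>W. exp (- 2 * \<Lambda>) * (\<Sum>\<^sub>\<infinity>x. exp (- (c / 32 * linf_dist x z))))) UNIV"
    by (rule has_sum_add)
  have "Re (l2_inner (\<psi> i) (\<psi> i)) \<le> (\<Sum>x\<in>T. (cmod (\<psi> i x))\<^sup>2)
      + (\<Sum>z\<in>W. exp (- 2 * \<Lambda>) * (\<Sum>\<^sub>\<infinity>x. exp (- (c / 32 * linf_dist x z))))"
  proof (rule has_sum_mono[OF has_sum_norm_sq[OF onfD(2)[OF onf_\<psi> iI]] hs])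
    fix x
    have nn: "0 \<le> (\<Sum>z\<in>W. exp (- 2 * \<Lambda>) * exp (- (c / 32 * linf_dist x z)))"
      by (intro sum_nonneg) simp
    show "(cmod (\<psi> i x))\<^sup>2 \<le> (if x \<in> T then (cmod (\<psi> i x))\<^sup>2 else 0)
        + (\<Sum>z\<in>W. exp (- 2 * \<Lambda>) * exp (- (c / 32 * linf_dist x z)))"
    proof (cases "x \<in> T")
      case True
      then show ?thesis using nn by simp
    next
      case False
      obtain z where z: "z \<in> W" "dset W x = linf_dist x z" by (rule dset_attained[OF W])
      have "R2 < linf_dist x z" using False z(1) by (auto simp: T_def lball_def)
      then have "320 * \<Lambda> < c * linf_dist x z" using c_pos by (simp add: field_simps)
      then have "8 * \<Lambda> - c / 16 * linf_dist x z \<le> - 2 * \<Lambda> - c / 32 * linf_dist x z" by simp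
      then have "exp (8 * \<Lambda>) * exp (- (c / 16 * linf_dist x z)) \<le> exp (- 2 * \<Lambda>) * exp (- (c / 32 * linf_dist x z))"
        by (simp add: exp_add[symmetric])
      also have "\<dots> \<le> (\<Sum>z\<in>W. exp (- 2 * \<Lambda>) * exp (- (c / 32 * linf_dist x z)))"
        by (rule member_le_sum[OF z(1) _ W(1)]) simp
      finally show ?thesis
        using False \<psi>_sq_decay[OF i, of x] z(2) by (simp add: W_def)
    qed
  qed
  then have "1 \<le> (\<Sum>x\<in>T. (cmod (\<psi> i x))\<^sup>2) + (\<Sum>z\<in>W. exp (- 2 * \<Lambda>) * (\<Sum>\<^sub>\<infinity>x. exp (- (c / 32 * linf_dist x z))))"
    using onfD(3)[OF onf_\<psi> iI] by simp
  moreover have "(\<Sum>z\<in>W. exp (- 2 * \<Lambda>) * (\<Sum>\<^sub>\<infinity>x. exp (- (c / 32 * linf_dist x z)))) \<le> 1 / 4"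
  proof -
    have "card W \<le> card Z" unfolding W_def Zc_def by (intro card_mono finite_Z) auto
    then have cW: "real (card W) \<le> 2 * exp \<Lambda>" using card_Z m_le by linarith
    have "(\<Sum>z\<in>W. exp (- 2 * \<Lambda>) * (\<Sum>\<^sub>\<infinity>x. exp (- (c / 32 * linf_dist x z)))) \<le> (\<Sum>z\<in>W. exp (- 2 * \<Lambda>) * S)"
      by (intro sum_mono mult_left_mono S_bound) simp
    also have "\<dots> = real (card W) * (exp (- 2 * \<Lambda>) * S)" by simp
    also have "\<dots> \<le> (2 * exp \<Lambda>) * (exp (- 2 * \<Lambda>) * S)"
      using cW S_nonneg by (intro mult_right_mono) auto
    also have "\<dots> = exp \<Lambda> * exp (- 2 * \<Lambda>) * (2 * S)" by simp
    also have "\<dots> \<le> exp \<Lambda> * exp (- 2 * \<Lambda>) * exp (\<Lambda> / 2)"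
      by (intro mult_left_mono S_le) simp
    also have "\<dots> = exp (- \<Lambda> / 2)" by (simp add: exp_add[symmetric])
    also have "\<dots> \<le> 1 / 4" using \<Lambda>_ge by (intro exp_le_quarter) simp
    finally show ?thesis .
  qed
  ultimately show ?thesis by (simp add: T_def W_def)
qed

lemma cluster_peaks:
  assumes n: "n \<in> \<nu> ` I"
  shows "\<exists>\<phi>. onf (In n) \<phi> \<and> kern (In n) \<phi> = kern (In n) \<psi> \<and> (\<forall>i\<in>In n. peak (1 / \<Lambda> ^ (CARD('a) + 1)) (\<phi> i))"
proof -
  define T where "T = (\<Union>z\<in>Zc n. lball z R2)"
  define V where "V = (2 * R2 + 1) ^ CARD('a)"
  \<comment> \<open>With \<open>r\<close> modes, the neighborhood has at most
    \<open>4 * r * V\<close> points, so this threshold uses \<open>r / 4\<close> of the trace.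
    Together with the \<open>r / 2\<close> needed for the greedy choice this is the available
    \<open>3 * r / 4\<close>. The rotation halves \<open>g\<close> to
    \<open>1 / (32 * V)\<close>.\<close>
  define g where "g = 1 / (16 * V)"
  have R2: "0 \<le> R2" using c_pos \<Lambda>_ge by simp
  then have V: "V > 0" by (simp add: V_def add_nonneg_pos)
  then have g: "g > 0" by (simp add: g_def)
  obtain i0 where i0: "i0 < m" "\<nu> i0 = n" using n by auto
  have "Zc n \<noteq> {}" using \<nu>_in[OF i0(1)] i0(2) by (intro Zc_nonempty) auto
  then obtain z where z: "z \<in> Zc n" by blast
  have "z \<in> lball z R2" using R2 by (simp add: lball_def)
  then have "z \<in> T" using z unfolding T_def by blast
  then have Tne: "T \<noteq> {}" by blast
  have fT: "finite T" unfolding T_def by (intro finite_UN_I finite_Zc finite_lball)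
  have "real (card T) \<le> real (\<Sum>z\<in>Zc n. card (lball z R2))"
    unfolding T_def by (intro of_nat_mono card_UN_le finite_Zc)
  also have "\<dots> \<le> (\<Sum>z\<in>Zc n. V)"
    unfolding of_nat_sum V_def by (intro sum_mono card_lball R2)
  also have "\<dots> = real (card (Zc n)) * V" by simp
  also have "\<dots> \<le> (4 * real (card (In n))) * V"
    using card_cluster[of n] V by (intro mult_right_mono) auto
  finally have "g * real (card T) \<le> g * (4 * real (card (In n)) * V)"
    using g by (intro mult_left_mono) auto
  also have "\<dots> = real (card (In n)) / 4" using V by (simp add: g_def)
  finally have "g * real (card T) + card (In n) / 2 \<le> (\<Sum>i\<in>In n. 3 / 4)" by simp
  also have "\<dots> \<le> (\<Sum>i\<in>In n. \<Sum>x\<in>T. (cmod (\<psi> i x))\<^sup>2)"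
    using mass_near_cluster by (intro sum_mono) (auto simp: In_def T_def)
  also have "\<dots> = (\<Sum>x\<in>T. Re (kern (In n) \<psi> x x))"
    unfolding kern_diag by (rule sum.swap)
  finally obtain \<phi> where \<phi>: "onf (In n) \<phi>" "kern (In n) \<phi> = kern (In n) \<psi>" "\<forall>i\<in>In n. peak (g / 2) (\<phi> i)"
    using onf_all_peaks[OF onf_In fT Tne g] by blast
  have "1 / \<Lambda> ^ (CARD('a) + 1) \<le> 1 / (32 * V)"
    using \<Lambda>_ball2 V by (intro divide_left_mono) (auto simp: V_def intro: mult_pos_pos less_le_trans)
  then have "1 / \<Lambda> ^ (CARD('a) + 1) \<le> g / 2" by (simp add: g_def)
  then have "\<forall>i\<in>In n. peak (1 / \<Lambda> ^ (CARD('a) + 1)) (\<phi> i)"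
    using \<phi>(3) unfolding peak_def by (meson order_trans)
  then show ?thesis using \<phi> by blast
qed

lemma localized_basis:
  "\<exists>\<phi>. onf I \<phi> \<and> kern I \<phi> = P \<and> (\<forall>i<m. peak (1 / \<Lambda> ^ (CARD('a) + 1)) (\<phi> i)) \<and>
    (\<forall>i<m. \<exists>xi. \<forall>y. cmod (\<phi> i y) \<le> exp (2 * \<Lambda>) * exp (- (c / 480) * linf_dist y xi / real m))"
proof -
  obtain \<Phi> where \<Phi>: "\<And>n. n \<in> \<nu> ` I \<Longrightarrow> onf (In n) (\<Phi> n)"
    "\<And>n. n \<in> \<nu> ` I \<Longrightarrow> kern (In n) (\<Phi> n) = kern (In n) \<psi>"
    "\<And>n i. n \<in> \<nu> ` I \<Longrightarrow> i \<in> In n \<Longrightarrow> peak (1 / \<Lambda> ^ (CARD('a) + 1)) (\<Phi> n i)"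
    using cluster_peaks by metis
  define \<phi> where "\<phi> i = \<Phi> (\<nu> i) i" for i
  have \<phi>: "onf I \<phi>" "kern I \<phi> = kern I \<psi>"
    using onf_glue[OF onf_\<psi>, of \<nu> \<Phi>] \<Phi>(1,2) unfolding In_def \<phi>_def by auto
  have mem: "\<nu> i \<in> \<nu> ` I" "i \<in> In (\<nu> i)" if "i < m" for i using that by (auto simp: In_def)
  have "peak (1 / \<Lambda> ^ (CARD('a) + 1)) (\<phi> i)" if "i < m" for i
    unfolding \<phi>_def by (rule \<Phi>(3)[OF mem[OF that]])
  moreover have "\<exists>xi. \<forall>y. cmod (\<phi> i y) \<le> exp (2 * \<Lambda>) * exp (- (c / 480) * linf_dist y xi / real m)" if i: "i < m" for i
  proof -
    define W where "W = Zc (\<nu> i)"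
    have W: "finite W" "W \<noteq> {}"
      unfolding W_def by (rule finite_Zc, rule Zc_nonempty[OF \<nu>_in[OF i]])
    then obtain xi where xi: "xi \<in> W" by blast
    have "cmod (\<phi> i y) \<le> exp (2 * \<Lambda>) * exp (- (c / 480) * linf_dist y xi / real m)" for y
    proof -
      \<comment> \<open>At most \<open>exp \<Lambda>\<close> modes, each with squared prefactor
        \<open>exp (8 * \<Lambda>)\<close>; half of the exponent \<open>9 * \<Lambda>\<close> is
        rounded up to \<open>5 * \<Lambda>\<close>.\<close>
      define E where "E = 5 * \<Lambda> - c / 32 * dset W y"
      have "(cmod (\<phi> i y))\<^sup>2 \<le> Re (kern (In (\<nu> i)) (\<Phi> (\<nu> i)) y y)"
        unfolding \<phi>_def using mem[OF i] by (intro norm_sq_le_kern_diag finite_In)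
      also have "\<dots> = (\<Sum>j\<in>In (\<nu> i). (cmod (\<psi> j y))\<^sup>2)"
        by (simp add: \<Phi>(2)[OF mem(1)[OF i]] kern_diag)
      also have "\<dots> \<le> (\<Sum>j\<in>In (\<nu> i). exp (8 * \<Lambda>) * exp (- (c / 16 * dset W y)))"
      proof (rule sum_mono)
        fix j assume "j \<in> In (\<nu> i)"
        then have "j < m" "\<nu> j = \<nu> i" by (auto simp: In_def)
        then show "(cmod (\<psi> j y))\<^sup>2 \<le> exp (8 * \<Lambda>) * exp (- (c / 16 * dset W y))"
          using \<psi>_sq_decay[of j y] by (simp add: W_def)
      qed
      also have "\<dots> = real (card (In (\<nu> i))) * (exp (8 * \<Lambda>) * exp (- (c / 16 * dset W y)))" by simp
      also have "\<dots> \<le> exp \<Lambda> * (exp (8 * \<Lambda>) * exp (- (c / 16 * dset W y)))"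
      proof (intro mult_right_mono)
        have "card (In (\<nu> i)) \<le> card I" by (intro card_mono) (auto simp: In_def)
        then show "real (card (In (\<nu> i))) \<le> exp \<Lambda>" using m_le by simp
      qed auto
      also have "\<dots> = exp (9 * \<Lambda> - c / 16 * dset W y)" by (simp add: exp_add[symmetric])
      also have "\<dots> \<le> exp (2 * E)" using \<Lambda>_ge by (simp add: E_def)
      also have "\<dots> = (exp E)\<^sup>2" by (simp add: power2_eq_square exp_add[symmetric])
      finally have 1: "cmod (\<phi> i y) \<le> exp E" by (rule power2_le_imp_le) simp
      have 2: "cmod (\<phi> i y) \<le> 1"
        using onfD(2,3)[OF \<phi>(1)] i by (intro unit_le_one) auto
      \<comment> \<open>The cluster diameter \<open>768 * m * \<Lambda> / c\<close> at rate
        \<open>c / 32\<close> costs \<open>24 * m * \<Lambda>\<close>. The power \<open>t\<close>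
        reduces \<open>5 * \<Lambda> + 24 * m * \<Lambda>\<close> to at most
        \<open>\<Lambda> / 3 + 8 * \<Lambda> / 5 \<le> 2 * \<Lambda>\<close> and the rate to
        \<open>c / (480 * m)\<close>.\<close>
      define t where "t = 1 / (15 * real m)"
      have t: "0 < t" "t \<le> 1 / 15" using m_pos by (auto simp: t_def field_simps)
      have "cmod (\<phi> i y) \<le> exp (t * E)"
      \<comment> \<open>For \<open>E \<ge> 0\<close> the pointwise bound 1 suffices; for
        \<open>E < 0\<close> the factor \<open>t \<le> 1\<close> only weakens
        \<open>exp E\<close>.\<close>
      proof (cases "E \<ge> 0")
        case True
        then have "0 \<le> t * E" using t by simp
        then show ?thesis using 2 by (meson one_le_exp_iff order_trans)
      next
        case False
        then have "1 * E \<le> t * E" using t by (intro mult_right_mono_neg) auto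
        then show ?thesis using 1 by (smt (verit) exp_le_cancel_iff)
      qed
      also have "t * E \<le> 2 * \<Lambda> - (c / 480) * linf_dist y xi / real m"
      proof -
        obtain z where z: "z \<in> W" "dset W y = linf_dist y z" by (rule dset_attained[OF W])
        have "linf_dist z xi \<le> 2 * card Z * (192 * \<Lambda> / c)"
          using z(1) xi by (intro lab_near) (auto simp: W_def Zc_def)
        also have "\<dots> \<le> 2 * (2 * m) * (192 * \<Lambda> / c)"
          using card_Z c_pos \<Lambda>_ge by (intro mult_right_mono) auto
        finally have "c * linf_dist z xi \<le> 768 * m * \<Lambda>" using c_pos by (simp add: field_simps)
        moreover have "c * linf_dist y xi \<le> c * (linf_dist y z + linf_dist z xi)"
          using c_pos by (intro mult_left_mono linf_triangle) simp
        ultimately have "c * linf_dist y xi \<le> c * dset W y + 768 * m * \<Lambda>"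
          by (simp add: z(2) distrib_left)
        then have "E \<le> 5 * \<Lambda> + 24 * m * \<Lambda> - c / 32 * linf_dist y xi" by (simp add: E_def)
        then have "t * E \<le> t * (5 * \<Lambda> + 24 * m * \<Lambda> - c / 32 * linf_dist y xi)"
          using t by (intro mult_left_mono) auto
        also have "\<dots> = t * (5 * \<Lambda>) + 24 / 15 * \<Lambda> - (c / 480) * linf_dist y xi / real m"
          using m_pos by (simp add: t_def field_simps)
        also have "t * (5 * \<Lambda>) \<le> 1 / 15 * (5 * \<Lambda>)" using t \<Lambda>_ge by (intro mult_right_mono) auto
        finally show ?thesis using \<Lambda>_ge by linarith
      qed
      finally show ?thesis by (simp add: exp_add[symmetric])
    qed
    then show ?thesis by blast
  qed
  ultimately show ?thesis using \<phi> by (metis kern_\<psi>)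
qed

end

lemma (in localized_projection) localized_basis_exists:
  "\<exists>\<phi>. onf I \<phi> \<and> kern I \<phi> = kern I b \<and> (\<forall>i<m. peak (1 / \<Lambda> ^ (CARD('d) + 1)) (\<phi> i)) \<and>
    (\<forall>i<m. \<exists>xi. \<forall>y. cmod (\<phi> i y) \<le> exp (2 * \<Lambda>) * exp (- (c / 480) * linf_dist y xi / real m))"
proof -
  obtain Z where Z: "separated Z" "Z \<noteq> {}" "\<And>x. x \<in> A0 \<Longrightarrow> \<exists>z\<in>Z. linf_dist x z \<le> 2 * R1"
    using centers_exist by blast
  have "finite Z" using Z(1) by (simp add: separated_def)
  moreover have "0 < 192 * \<Lambda> / c" using c_pos \<Lambda>_ge by simp
  ultimately obtain lab where lab: "\<forall>z\<in>Z. lab z < card Z"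
    "\<forall>z\<in>Z. \<forall>z'\<in>Z. (lab z = lab z' \<longrightarrow> linf_dist z z' \<le> 2 * card Z * (192 * \<Lambda> / c)) \<and>
      (lab z \<noteq> lab z' \<longrightarrow> linf_dist z z' > 192 * \<Lambda> / c)"
    using cluster_labels by blast
  interpret clustered_projection b m c \<Lambda> S Z lab
    by unfold_locales (use Z lab in auto)
  obtain \<psi> \<nu> where "onf I \<psi>" "kern I \<psi> = P" "\<And>i. i < m \<Longrightarrow> \<nu> i \<in> lab ` Z"
    "\<And>i y. i < m \<Longrightarrow> cmod (\<psi> i y) \<le> exp (4 * \<Lambda>) * exp (- (c / 32 * dset (Zc (\<nu> i)) y))"
    using eigenmodes_exist by metis
  then interpret clustered_modes b m c \<Lambda> S Z lab \<psi> \<nu>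
    by unfold_locales auto
  show ?thesis using localized_basis by (simp add: P_def)
qed

section \<open>Choice of constants and conclusion\<close>

lemma parameters_large:
  fixes c S \<Lambda> :: real
  assumes c: "0 < c" and S: "0 < S"
    and \<Lambda>: "4 + 4 * S + (16 / c + 1) ^ n * fact (Suc n) + 32 * (640 / c + 1) ^ n \<le> \<Lambda>"
  shows "4 \<le> \<Lambda>" "2 * S \<le> exp (\<Lambda> / 2)" "(2 * (8 * \<Lambda> / c) + 1) ^ n \<le> exp \<Lambda>"
    "32 * (2 * (320 * \<Lambda> / c) + 1) ^ n \<le> \<Lambda> ^ (n + 1)"
proof -
  have nn: "0 \<le> (16 / c + 1) ^ n * fact (Suc n)" "0 \<le> (640 / c + 1) ^ n"
    using c by (auto intro!: mult_nonneg_nonneg zero_le_power add_nonneg_nonneg)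
  then show \<Lambda>4: "4 \<le> \<Lambda>" using \<Lambda> S by linarith
  have \<Lambda>S: "4 * S \<le> \<Lambda>" and \<Lambda>1: "(16 / c + 1) ^ n * fact (Suc n) \<le> \<Lambda>" and \<Lambda>2: "32 * (640 / c + 1) ^ n \<le> \<Lambda>"
    using nn \<Lambda> S by linarith+
  show "2 * S \<le> exp (\<Lambda> / 2)" using exp_ge_add_one_self[of "\<Lambda> / 2"] \<Lambda>S by linarith
  have lin: "(a * \<Lambda> + 1) ^ n \<le> (a + 1) ^ n * \<Lambda> ^ n" if "0 \<le> a" for a
    unfolding power_mult_distrib[symmetric] using that \<Lambda>4
    by (intro power_mono) (auto simp: distrib_right)
  \<comment> \<open>The extra \<open>\<Lambda>\<close> makes room for a constant:
    \<open>\<Lambda> ^ Suc n \<le> fact (Suc n) * exp \<Lambda>\<close> leaves one that is at most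
    \<open>\<Lambda>\<close>, and \<open>\<Lambda>\<close> cancels.\<close>
  have "\<Lambda> * (16 / c * \<Lambda> + 1) ^ n \<le> \<Lambda> * ((16 / c + 1) ^ n * \<Lambda> ^ n)"
    using lin[of "16 / c"] c \<Lambda>4 by (intro mult_left_mono) auto
  also have "\<dots> = (16 / c + 1) ^ n * \<Lambda> ^ Suc n" by simp
  also have "\<dots> \<le> (16 / c + 1) ^ n * (fact (Suc n) * exp \<Lambda>)"
    using c \<Lambda>4 by (intro mult_left_mono power_le_fact_exp) auto
  also have "\<dots> = (16 / c + 1) ^ n * fact (Suc n) * exp \<Lambda>" by simp
  also have "\<dots> \<le> \<Lambda> * exp \<Lambda>" by (intro mult_right_mono \<Lambda>1) simp
  finally show "(2 * (8 * \<Lambda> / c) + 1) ^ n \<le> exp \<Lambda>" using \<Lambda>4 by simp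
  have "32 * (640 / c * \<Lambda> + 1) ^ n \<le> 32 * ((640 / c + 1) ^ n * \<Lambda> ^ n)"
    using lin[of "640 / c"] c by (intro mult_left_mono) auto
  also have "\<dots> = 32 * (640 / c + 1) ^ n * \<Lambda> ^ n" by simp
  \<comment> \<open>The origin of the exponent \<open>d + 1\<close> in the theorem: one spare
    \<open>\<Lambda>\<close> absorbs the constant.\<close>
  also have "\<dots> \<le> \<Lambda> * \<Lambda> ^ n" using \<Lambda>4 by (intro mult_right_mono \<Lambda>2) simp
  finally show "32 * (2 * (320 * \<Lambda> / c) + 1) ^ n \<le> \<Lambda> ^ (n + 1)" by simp
qed

lemma peak_Mmax:
  assumes "peak g \<psi>" "in_l2 \<psi>" "l2_inner \<psi> \<psi> = 1"
  shows "g \<le> Mmax \<psi>"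
proof -
  obtain x where x: "g \<le> (cmod (\<psi> x))\<^sup>2" using assms(1) by (auto simp: peak_def)
  have "bdd_above (range (\<lambda>x. (cmod (\<psi> x))\<^sup>2))"
    using unit_le_one[OF assms(2,3)] by (intro bdd_aboveI[of _ 1]) (auto simp: abs_square_le_1)
  then have "(cmod (\<psi> x))\<^sup>2 \<le> Mmax \<psi>" unfolding Mmax_def by (rule cSUP_upper[rotated]) simp
  then show ?thesis using x by linarith
qed

theorem theoremB2:
  fixes c :: real
  assumes "c > 0"
  shows "\<exists>\<epsilon>>0. \<exists>c'>0. \<forall>(m::nat) (\<theta>::real) (P :: 'd::finite lat \<Rightarrow> 'd lat \<Rightarrow> complex).
     \<theta> > 0 \<and> real m ^ 3 * \<theta> < \<epsilon> \<and> rank_orth_proj m P \<and>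
     (\<forall>x y. cmod (P x y) * exp (c * linf_dist x y) \<le> 1 / \<theta>)
     \<longrightarrow> (\<exists>\<psi> :: nat \<Rightarrow> ('d lat \<Rightarrow> complex).
            (\<forall>i<m. in_l2 (\<psi> i) \<and> l2_inner (\<psi> i) (\<psi> i) = 1) \<and>
            (\<forall>i<m. \<forall>j<m. i \<noteq> j \<longrightarrow> l2_inner (\<psi> i) (\<psi> j) = 0) \<and>
            (\<forall>x y. P x y = (\<Sum>i<m. \<psi> i x * cnj (\<psi> i y))) \<and>
            (\<forall>i<m. Mmax (\<psi> i) \<ge> 1 / \<bar>ln \<theta>\<bar> ^ (CARD('d) + 1)) \<and>
            (\<forall>i<m. \<exists>xi. \<forall>y. cmod (\<psi> i y) \<le> \<theta> powr (-2) * exp (- c' * linf_dist y xi / real m)))"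
proof -
  obtain S where S: "S > 0"
    "\<And>z::'d lat. (\<lambda>x. exp (- (c / 32 * linf_dist x z))) summable_on UNIV"
    "\<And>z::'d lat. (\<Sum>\<^sub>\<infinity>x. exp (- (c / 32 * linf_dist x z))) \<le> S"
    using exp_linf_summable[of "c / 32"] assms by auto
  \<comment> \<open>Nonnegative summands, one for each largeness requirement on
    \<open>\<Lambda>\<close>, depending only on \<open>c\<close> and the dimension.\<close>
  define \<Lambda>0 where "\<Lambda>0 = 4 + 4 * S + (16 / c + 1) ^ CARD('d) * fact (Suc CARD('d)) + 32 * (640 / c + 1) ^ CARD('d)"
  have "0 \<le> (16 / c + 1) ^ CARD('d) * fact (Suc CARD('d))" "0 \<le> 32 * (640 / c + 1) ^ CARD('d)"
    using assms by (auto intro!: mult_nonneg_nonneg zero_le_power add_nonneg_nonneg)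
  then have \<Lambda>0: "\<Lambda>0 \<ge> 0" using S(1) by (simp add: \<Lambda>0_def)
  show ?thesis
  proof (rule exI[of _ "exp (- \<Lambda>0)"], rule conjI[OF exp_gt_zero], rule exI[of _ "c / 480"],
      rule conjI, use assms in simp, intro allI impI, elim conjE)
    fix m :: nat and \<theta> :: real and P :: "'d lat \<Rightarrow> 'd lat \<Rightarrow> complex"
    assume \<theta>: "0 < \<theta>" and small: "real m ^ 3 * \<theta> < exp (- \<Lambda>0)" and rk: "rank_orth_proj m P"
      and dec: "\<forall>x y. cmod (P x y) * exp (c * linf_dist x y) \<le> 1 / \<theta>"
    obtain e where e: "onf {..<m} e" "P = kern {..<m} e" by (rule rank_orth_proj_onf[OF rk])
    define \<Lambda> where "\<Lambda> = - ln \<theta>"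
    have e\<Lambda>: "exp \<Lambda> = 1 / \<theta>" using \<theta> by (simp add: \<Lambda>_def exp_minus inverse_eq_divide)
    have "\<exists>\<phi>. onf {..<m} \<phi> \<and> kern {..<m} \<phi> = P \<and>
        (\<forall>i<m. peak (1 / \<bar>ln \<theta>\<bar> ^ (CARD('d) + 1)) (\<phi> i)) \<and>
        (\<forall>i<m. \<exists>xi. \<forall>y. cmod (\<phi> i y) \<le> \<theta> powr (-2) * exp (- (c / 480) * linf_dist y xi / real m))"
    \<comment> \<open>For \<open>m = 0\<close> the smallness hypothesis does not bound
      \<open>\<theta>\<close>, but the claims over \<open>i < m\<close> are vacuous.\<close>
    proof (cases "m = 0")
      case True
      then show ?thesis using e by (intro exI[of _ e]) auto
    next
      case False
      then have m1: "1 \<le> real m" by simp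
      have "1 * \<theta> \<le> real m ^ 3 * \<theta>" using m1 \<theta> by (intro mult_right_mono one_le_power) auto
      then have "\<theta> < exp (- \<Lambda>0)" using small by simp
      then have "ln \<theta> < - \<Lambda>0" using \<theta> by (metis ln_exp ln_less_cancel_iff exp_gt_zero)
      then have \<Lambda>: "\<Lambda>0 \<le> \<Lambda>" by (simp add: \<Lambda>_def)
      \<comment> \<open>Since \<open>m \<le> m^3\<close>, the hypothesis yields
        \<open>m * \<theta> \<le> 1\<close>, that is \<open>m \<le> exp \<Lambda>\<close>.\<close>
      have "real m ^ 1 * \<theta> \<le> real m ^ 3 * \<theta>"
        using m1 \<theta> by (intro mult_right_mono power_increasing) auto
      also have "\<dots> \<le> 1" using small \<Lambda>0 by (smt (verit) exp_le_one_iff)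
      finally have m\<Lambda>: "real m \<le> exp \<Lambda>" using \<theta> by (simp add: e\<Lambda> field_simps)
      have kd: "cmod (kern {..<m} e x y) \<le> exp (\<Lambda> - c * linf_dist x y)" for x y
        using dec[rule_format, of x y] unfolding e\<Lambda>[symmetric] by (simp add: e(2) exp_diff field_simps)
      note big = parameters_large[OF assms S(1) \<Lambda>[unfolded \<Lambda>0_def]]
      interpret localized_projection e m c \<Lambda> S
        using False m\<Lambda> assms big e(1) kd S by unfold_locales auto
      have "\<bar>ln \<theta>\<bar> = \<Lambda>" using big(1) by (simp add: \<Lambda>_def)
      moreover have "\<theta> powr (-2) = exp (2 * \<Lambda>)" using \<theta> by (simp add: powr_def \<Lambda>_def)
      ultimately show ?thesis using localized_basis_exists by (simp only: e(2))
    qed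
    then obtain \<phi> where \<phi>: "onf {..<m} \<phi>" "kern {..<m} \<phi> = P"
      "\<forall>i<m. peak (1 / \<bar>ln \<theta>\<bar> ^ (CARD('d) + 1)) (\<phi> i)"
      "\<forall>i<m. \<exists>xi. \<forall>y. cmod (\<phi> i y) \<le> \<theta> powr (-2) * exp (- (c / 480) * linf_dist y xi / real m)"
      by blast
    show "\<exists>\<psi> :: nat \<Rightarrow> ('d lat \<Rightarrow> complex).
            (\<forall>i<m. in_l2 (\<psi> i) \<and> l2_inner (\<psi> i) (\<psi> i) = 1) \<and>
            (\<forall>i<m. \<forall>j<m. i \<noteq> j \<longrightarrow> l2_inner (\<psi> i) (\<psi> j) = 0) \<and>
            (\<forall>x y. P x y = (\<Sum>i<m. \<psi> i x * cnj (\<psi> i y))) \<and>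
            (\<forall>i<m. Mmax (\<psi> i) \<ge> 1 / \<bar>ln \<theta>\<bar> ^ (CARD('d) + 1)) \<and>
            (\<forall>i<m. \<exists>xi. \<forall>y. cmod (\<psi> i y) \<le> \<theta> powr (-2) * exp (- (c / 480) * linf_dist y xi / real m))"
    proof (intro exI[of _ \<phi>] conjI)
      show "\<forall>x y. P x y = (\<Sum>i<m. \<phi> i x * cnj (\<phi> i y))"
        by (simp add: \<phi>(2)[symmetric] kern_def)
      show "\<forall>i<m. Mmax (\<phi> i) \<ge> 1 / \<bar>ln \<theta>\<bar> ^ (CARD('d) + 1)"
        using \<phi>(3) onfD(2,3)[OF \<phi>(1)] by (auto intro!: peak_Mmax)
      show "\<forall>i<m. in_l2 (\<phi> i) \<and> l2_inner (\<phi> i) (\<phi> i) = 1"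
        "\<forall>i<m. \<forall>j<m. i \<noteq> j \<longrightarrow> l2_inner (\<phi> i) (\<phi> j) = 0"
        using onfD[OF \<phi>(1)] by auto
    qed (rule \<phi>(4))
  qed
qed

end
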